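(* Let $d$ be even and let $f$ be a homogeneous $n$-variate polynomial of degree $d$. Write $f=\sum_{\alpha\in\mathbb{N}^n,\ |\alpha|\le d/2}f_{2\alpha}(x)\,x^{2\alpha}$, where each $f_{2\alpha}$ is a homogeneous multilinear polynomial of degree $d-2|\alpha|$ (this representation is unique). Then \[\frac{\Lambda(f)}{\|f\|_2}\le 2^{O(d)}\max_{\alpha\in\mathbb{N}^n,\ |\alpha|\le d/2}\frac{\Lambda(f_{2\alpha})}{\|f_{2\alpha}\|_2}.\]
   Context: For a multi-index $\alpha\in\mathbb{N}^n$, $|\alpha|=\sum_i\alpha_i$ and $x^\alpha=\prod_i x_i^{\alpha_i}$; a polynomial is multilinear if every monomial with non-zero coefficient has all exponents at most 1. $\|h\|_2:=\sup_{\|x\|_2=1}|h(x)|$. For a homogeneous polynomial $h$ of even degree $t$, a matrix representation is a symmetric $M\in\mathbb{R}^{[n]^{t/2}\times[n]^{t/2}}$ with $(x^{\otimes t/2})^TMx^{\otimes t/2}=h(x)$ for all $x$, and $\Lambda(h):=\inf\{\sup_{\|z\|_2=1}z^TMz:\ M\text{ a matrix representation of }h\}$ (for $t=0$, $h$ is a constant and $\Lambda(h)=h$). *)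

theory Defs
  imports "HOL-Analysis.L2_Norm" "HOL-Library.Poly_Mapping"
begin

text \<open>Real polynomials in the variables \<open>x\<^sub>0, x\<^sub>1, \<dots>\<close>: finitely supported maps from
  multi-indices to coefficients, with the ring structure of \<^theory>\<open>HOL-Library.Poly_Mapping\<close>.
  The \<open>n\<close>-variate ones are those whose monomials only involve variables with index \<open>< n\<close>.\<close>

type_synonym multi_index = "nat \<Rightarrow>\<^sub>0 nat"
type_synonym rpoly = "multi_index \<Rightarrow>\<^sub>0 real"

definition mdeg :: "multi_index \<Rightarrow> nat" where
  "mdeg \<alpha> = (\<Sum>i\<in>Poly_Mapping.keys \<alpha>. Poly_Mapping.lookup \<alpha> i)"

definition monom_eval :: "multi_index \<Rightarrow> (nat \<Rightarrow> real) \<Rightarrow> real" where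
  "monom_eval \<alpha> x = (\<Prod>i\<in>Poly_Mapping.keys \<alpha>. x i ^ Poly_Mapping.lookup \<alpha> i)"

definition peval :: "rpoly \<Rightarrow> (nat \<Rightarrow> real) \<Rightarrow> real" where
  "peval p x = (\<Sum>\<alpha>\<in>Poly_Mapping.keys p. Poly_Mapping.lookup p \<alpha> * monom_eval \<alpha> x)"

definition variate :: "nat \<Rightarrow> rpoly \<Rightarrow> bool" where
  "variate n p \<longleftrightarrow> (\<forall>\<alpha>\<in>Poly_Mapping.keys p. Poly_Mapping.keys \<alpha> \<subseteq> {..<n})"

text \<open>The zero polynomial is homogeneous of every degree.\<close>

definition homogeneous :: "nat \<Rightarrow> rpoly \<Rightarrow> bool" where
  "homogeneous d p \<longleftrightarrow> (\<forall>\<alpha>\<in>Poly_Mapping.keys p. mdeg \<alpha> = d)"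

definition multilinear :: "rpoly \<Rightarrow> bool" where
  "multilinear p \<longleftrightarrow> (\<forall>\<alpha>\<in>Poly_Mapping.keys p. \<forall>i. Poly_Mapping.lookup \<alpha> i \<le> 1)"

text \<open>For \<open>n \<ge> 1\<close>, \<open>sphere_norm n 0 = 0\<close>, so a ratio \<open>Lambda n t h / sphere_norm n h\<close> with
  \<open>h = 0\<close> is \<open>0 / 0 = 0\<close>.\<close>

definition sphere_norm :: "nat \<Rightarrow> rpoly \<Rightarrow> real" where
  "sphere_norm n h = (SUP x\<in>{x. L2_set x {..<n} = 1}. \<bar>peval h x\<bar>)"

text \<open>Tuples in \<open>[n]\<^sup>k\<close> are lists. Vectors and matrices indexed by them are total functions
  of which only the values on \<open>tuples n k\<close> matter.\<close>

definition tuples :: "nat \<Rightarrow> nat \<Rightarrow> nat list set" where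
  "tuples n k = {I. set I \<subseteq> {..<n} \<and> length I = k}"

definition tensor_power :: "(nat \<Rightarrow> real) \<Rightarrow> nat list \<Rightarrow> real" where
  "tensor_power x I = (\<Prod>i\<leftarrow>I. x i)"

definition quad_form ::
  "nat \<Rightarrow> nat \<Rightarrow> (nat list \<Rightarrow> nat list \<Rightarrow> real) \<Rightarrow> (nat list \<Rightarrow> real) \<Rightarrow> real" where
  "quad_form n k M z = (\<Sum>I\<in>tuples n k. \<Sum>J\<in>tuples n k. z I * M I J * z J)"

definition matrix_rep ::
  "nat \<Rightarrow> nat \<Rightarrow> rpoly \<Rightarrow> (nat list \<Rightarrow> nat list \<Rightarrow> real) \<Rightarrow> bool" where
  "matrix_rep n t h M \<longleftrightarrow>
     (\<forall>I\<in>tuples n (t div 2). \<forall>J\<in>tuples n (t div 2). M I J = M J I) \<and>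
     (\<forall>x. quad_form n (t div 2) M (tensor_power x) = peval h x)"

text \<open>The degree \<open>t\<close> (assumed even) is a parameter because the zero polynomial does not
  determine it. For \<open>t = 0\<close> the matrices are \<open>1 \<times> 1\<close>, and the definition yields the constant
  itself, see \<open>Lambda_const\<close>.\<close>

definition Lambda :: "nat \<Rightarrow> nat \<Rightarrow> rpoly \<Rightarrow> real" where
  "Lambda n t h = (INF M\<in>{M. matrix_rep n t h M}.
     SUP z\<in>{z. L2_set z (tuples n (t div 2)) = 1}. quad_form n (t div 2) M z)"

lemma Lambda_const: "Lambda n 0 (Poly_Mapping.single 0 c) = c"
proof -
  have t: "tuples n 0 = {[]}"
    by (auto simp: tuples_def)
  have p: "peval (Poly_Mapping.single 0 c) x = c" for x
    by (simp add: peval_def monom_eval_def)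
  have rep: "matrix_rep n 0 (Poly_Mapping.single 0 c) M \<longleftrightarrow> M [] [] = c" for M
    by (auto simp: matrix_rep_def quad_form_def t p tensor_power_def)
  have q: "quad_form n 0 M z = c" if "M [] [] = c" "L2_set z (tuples n 0) = 1" for M z
  proof -
    have "z [] * z [] = 1"
      using that(2) by (simp add: t L2_set_def abs_square_eq_1 flip: power2_eq_square)
    then show ?thesis
      using that(1) by (simp add: quad_form_def t algebra_simps)
  qed
  have ex: "(\<lambda>_. 1) \<in> {z. L2_set z (tuples n 0) = 1}"
    by (simp add: t)
  have s: "(SUP z\<in>{z. L2_set z (tuples n 0) = 1}. quad_form n 0 M z) = c"
    if "M [] [] = c" for M
  proof -
    have "quad_form n 0 M ` {z. L2_set z (tuples n 0) = 1} = {c}"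
      using q[of M] that ex by (auto simp: image_iff intro!: exI[where x = "\<lambda>_. 1"])
    then show ?thesis
      by simp
  qed
  have "(\<lambda>M. SUP z\<in>{z. L2_set z (tuples n 0) = 1}. quad_form n 0 M z) ` {M. M [] [] = c} = {c}"
    using s by (auto intro!: image_eqI[where x = "\<lambda>_ _. c"])
  then show ?thesis
    by (simp add: Lambda_def rep)
qed

definition multi_indices :: "nat \<Rightarrow> nat \<Rightarrow> multi_index set" where
  "multi_indices n k = {\<alpha>. Poly_Mapping.keys \<alpha> \<subseteq> {..<n} \<and> mdeg \<alpha> \<le> k}"

text \<open>\<open>F \<alpha>\<close> plays the role of \<open>f\<^sub>2\<^sub>\<alpha>\<close>. The last conjunct fixes the irrelevant values of \<open>F\<close>
  outside the index set, so that uniqueness of the decomposition can be stated for \<open>F\<close> itself.\<close>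

definition multilinear_decomposition ::
  "nat \<Rightarrow> nat \<Rightarrow> rpoly \<Rightarrow> (multi_index \<Rightarrow> rpoly) \<Rightarrow> bool" where
  "multilinear_decomposition n d f F \<longleftrightarrow>
     (\<forall>\<alpha>\<in>multi_indices n (d div 2).
        variate n (F \<alpha>) \<and> homogeneous (d - 2 * mdeg \<alpha>) (F \<alpha>) \<and> multilinear (F \<alpha>)) \<and>
     f = (\<Sum>\<alpha>\<in>multi_indices n (d div 2). F \<alpha> * Poly_Mapping.single (\<alpha> + \<alpha>) 1) \<and>
     (\<forall>\<alpha>. \<alpha> \<notin> multi_indices n (d div 2) \<longrightarrow> F \<alpha> = 0)"

end

theory Submission
  imports Defs "HOL-Combinatorics.Multiset_Permutations"
    "HOL-Computational_Algebra.Polynomial" "HOL-Library.FuncSet"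
begin

text \<open>Let \<open>N(\<alpha>)\<close> be the number of tuples in which every \<open>i\<close> occurs \<open>\<alpha>\<^sub>i\<close> times. Writing
  \<open>x ^ 2\<alpha>\<close> as the average over these tuples \<open>P\<close> of the squares of the monomials \<open>x ^ P\<close> turns matrix
  representations of the \<open>f\<^sub>2\<^sub>\<alpha>\<close> into a representation of \<open>f\<close> that is a sum over \<open>k \<le> d/2\<close> of
  block diagonal matrices, so \<open>\<Lambda>(f)\<close> is at most \<open>d/2 + 1\<close> times the maximum of
  \<open>\<Lambda>(f\<^sub>2\<^sub>\<alpha>) / N(\<alpha>)\<close>.

  Conversely \<open>\<parallel>f\<^sub>2\<^sub>\<alpha>\<parallel> \<le> 36 ^ d * N(\<alpha>) * \<parallel>f\<parallel>\<close>. With \<open>k = \<bar>\<alpha>\<bar>\<close>, average \<open>f\<close> over independent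
  complex phases of the coordinates, at radii \<open>r\<^sub>i = 2 * \<bar>x\<^sub>i\<bar> + sqrt (\<alpha>\<^sub>i / k)\<close> and with weights of
  total mass at most \<open>2 ^ k\<close>, so as to kill all monomials except those of \<open>f\<^sub>2\<^sub>\<alpha> * x ^ 2\<alpha>\<close>. This
  yields \<open>r ^ 2\<alpha> * f\<^sub>2\<^sub>\<alpha>(x)\<close>, where
  \<open>r ^ 2\<alpha> \<ge> (\<Prod>i. (\<alpha>\<^sub>i / k) ^ \<alpha>\<^sub>i) \<ge> 1 / (3 ^ k * N(\<alpha>))\<close>. Passing to complex arguments costs a
  factor \<open>2 ^ d\<close>. All averages are taken over roots of unity.\<close>

section \<open>Evaluation of polynomials\<close>

abbreviation "lookup \<equiv> Poly_Mapping.lookup"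
abbreviation "keys \<equiv> Poly_Mapping.keys"
abbreviation "single \<equiv> Poly_Mapping.single"

text \<open>The target ring is left open so that the same facts serve real points and the complex
  points over which \<open>f\<close> is averaged later.\<close>

definition monom_val :: "multi_index \<Rightarrow> (nat \<Rightarrow> 'a::comm_semiring_1) \<Rightarrow> 'a" where
  "monom_val \<alpha> x = (\<Prod>i\<in>keys \<alpha>. x i ^ lookup \<alpha> i)"

definition poly_val :: "rpoly \<Rightarrow> (nat \<Rightarrow> 'a::{real_algebra_1,comm_ring_1}) \<Rightarrow> 'a" where
  "poly_val p x = (\<Sum>\<alpha>\<in>keys p. of_real (lookup p \<alpha>) * monom_val \<alpha> x)"

lemma monom_eval_eq_monom_val: "monom_eval \<alpha> x = monom_val \<alpha> x"
  by (simp add: monom_eval_def monom_val_def)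

lemma peval_eq_poly_val: "peval p x = poly_val p x"
  by (simp add: peval_def poly_val_def monom_eval_eq_monom_val)

lemma monom_val_superset:
  assumes "finite A" "keys \<alpha> \<subseteq> A"
  shows "monom_val \<alpha> x = (\<Prod>i\<in>A. x i ^ lookup \<alpha> i)"
  unfolding monom_val_def using assms
  by (intro prod.mono_neutral_left) (auto simp: in_keys_iff)

lemma monom_val_0 [simp]: "monom_val 0 x = 1"
  by (simp add: monom_val_def)

lemma monom_val_single [simp]: "monom_val (single i k) x = x i ^ k"
  by (simp add: monom_val_def)

lemma monom_val_add: "monom_val (\<alpha> + \<beta>) x = monom_val \<alpha> x * monom_val \<beta> x"
proof -
  let ?A = "keys \<alpha> \<union> keys \<beta>"
  have "keys (\<alpha> + \<beta>) \<subseteq> ?A" by (rule Poly_Mapping.keys_add)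
  then show ?thesis
    by (simp add: monom_val_superset[of ?A] lookup_add power_add prod.distrib)
qed

lemma mdeg_superset:
  assumes "finite A" "keys \<alpha> \<subseteq> A"
  shows "mdeg \<alpha> = (\<Sum>i\<in>A. lookup \<alpha> i)"
  unfolding mdeg_def using assms
  by (intro sum.mono_neutral_left) (auto simp: in_keys_iff)

lemma mdeg_0 [simp]: "mdeg 0 = 0"
  by (simp add: mdeg_def)

lemma mdeg_single [simp]: "mdeg (single i k) = k"
  by (simp add: mdeg_def)

lemma mdeg_add: "mdeg (\<alpha> + \<beta>) = mdeg \<alpha> + mdeg \<beta>"
proof -
  let ?A = "keys \<alpha> \<union> keys \<beta>"
  have "keys (\<alpha> + \<beta>) \<subseteq> ?A" by (rule Poly_Mapping.keys_add)
  then show ?thesis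
    by (simp add: mdeg_superset[of ?A] lookup_add sum.distrib)
qed

lemma lookup_le_mdeg: "lookup \<alpha> i \<le> mdeg \<alpha>"
proof (cases "i \<in> keys \<alpha>")
  case True
  then show ?thesis unfolding mdeg_def by (intro member_le_sum) auto
qed (simp add: in_keys_iff)

lemma finite_multi_indices: "finite (multi_indices n k)"
proof -
  have "multi_indices n k \<subseteq> (\<lambda>f. Abs_poly_mapping f) `
     {f. \<forall>i. (i \<in> {..<n} \<longrightarrow> f i \<in> {..k}) \<and> (i \<notin> {..<n} \<longrightarrow> f i = 0)}"
  proof
    fix \<alpha> assume \<alpha>: "\<alpha> \<in> multi_indices n k"
    have "lookup \<alpha> i \<le> k" for i
      using \<alpha> lookup_le_mdeg[of \<alpha> i] by (auto simp: multi_indices_def)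
    moreover have "lookup \<alpha> i = 0" if "i \<notin> {..<n}" for i
      using \<alpha> that unfolding multi_indices_def in_keys_iff[symmetric] by (auto simp: in_keys_iff)
    ultimately show "\<alpha> \<in> (\<lambda>f. Abs_poly_mapping f) `
       {f. \<forall>i. (i \<in> {..<n} \<longrightarrow> f i \<in> {..k}) \<and> (i \<notin> {..<n} \<longrightarrow> f i = 0)}"
      by (intro image_eqI[of _ _ "lookup \<alpha>"]) (auto simp: lookup_inverse)
  qed
  then show ?thesis
    by (rule finite_subset) (intro finite_imageI finite_set_of_finite_funs, auto)
qed

lemma zero_in_multi_indices [simp]: "0 \<in> multi_indices n k"
  by (simp add: multi_indices_def)

lemma poly_eq_sum_single: "p = (\<Sum>\<alpha>\<in>keys p. single \<alpha> (lookup p \<alpha>))"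
proof (rule poly_mapping_eqI)
  fix \<beta>
  show "lookup p \<beta> = lookup (\<Sum>\<alpha>\<in>keys p. single \<alpha> (lookup p \<alpha>)) \<beta>"
    by (auto simp: lookup_sum lookup_single when_def in_keys_iff)
qed

lemma poly_val_0 [simp]: "poly_val 0 x = 0"
  by (simp add: poly_val_def)

lemma poly_val_single [simp]: "poly_val (single \<alpha> c) x = of_real c * monom_val \<alpha> x"
  by (simp add: poly_val_def)

lemma poly_val_add: "poly_val (p + q) x = poly_val p x + poly_val q x"
  unfolding poly_val_def
  by (rule setsum_keys_plus_distrib) (simp_all add: algebra_simps)

lemma poly_val_sum: "poly_val (sum p A) x = (\<Sum>i\<in>A. poly_val (p i) x)"
  by (induction A rule: infinite_finite_induct) (simp_all add: poly_val_add)

lemma poly_val_mult_single: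
  "poly_val (p * single \<delta> 1) x = poly_val p x * monom_val \<delta> x"
proof -
  have "p * single \<delta> 1 = (\<Sum>\<alpha>\<in>keys p. single \<alpha> (lookup p \<alpha>)) * single \<delta> 1"
    using poly_eq_sum_single[of p] by simp
  also have "\<dots> = (\<Sum>\<alpha>\<in>keys p. single (\<alpha> + \<delta>) (lookup p \<alpha>))"
    by (simp add: sum_distrib_right mult_single)
  finally have "poly_val (p * single \<delta> 1) x
      = (\<Sum>\<alpha>\<in>keys p. of_real (lookup p \<alpha>) * monom_val \<alpha> x * monom_val \<delta> x)"
    by (simp add: poly_val_sum monom_val_add mult.assoc)
  then show ?thesis
    by (simp add: poly_val_def sum_distrib_right)
qed

lemma poly_val_of_real: "poly_val p (\<lambda>i. complex_of_real (x i)) = of_real (poly_val p x)"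
  by (simp add: poly_val_def monom_val_def)

lemma monom_val_scale: "monom_val \<alpha> (\<lambda>i. c * x i) = c ^ mdeg \<alpha> * monom_val \<alpha> x"
  by (simp add: monom_val_def mdeg_def power_mult_distrib prod.distrib power_sum)

lemma poly_val_scale:
  assumes "homogeneous d p"
  shows "poly_val p (\<lambda>i. c * x i) = c ^ d * poly_val p x"
proof -
  have "poly_val p (\<lambda>i. c * x i) = (\<Sum>\<alpha>\<in>keys p. c ^ d * (of_real (lookup p \<alpha>) * monom_val \<alpha> x))"
    unfolding poly_val_def using assms
    by (intro sum.cong) (auto simp: homogeneous_def monom_val_scale algebra_simps)
  then show ?thesis by (simp add: poly_val_def sum_distrib_left)
qed

lemma poly_val_cong:
  assumes "variate n p" "\<And>i. i < n \<Longrightarrow> x i = y i"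
  shows "poly_val p x = poly_val p y"
  using assms unfolding poly_val_def monom_val_def variate_def
  by (intro sum.cong refl arg_cong2[where f = "(*)"] prod.cong arg_cong2[where f = power]) auto

section \<open>The multilinear decomposition\<close>

lemma lookup_mult_single_add:
  fixes p :: rpoly
  shows "lookup (p * single \<delta> 1) (\<delta> + \<gamma>) = lookup p \<gamma>"
proof -
  have "p * single \<delta> 1 = (\<Sum>\<alpha>\<in>keys p. single \<alpha> (lookup p \<alpha>)) * single \<delta> 1"
    using poly_eq_sum_single[of p] by simp
  also have "\<dots> = (\<Sum>\<alpha>\<in>keys p. single (\<alpha> + \<delta>) (lookup p \<alpha>))"
    by (simp add: sum_distrib_right mult_single)
  finally have "lookup (p * single \<delta> 1) (\<delta> + \<gamma>)
      = (\<Sum>\<alpha>\<in>keys p. if \<alpha> + \<delta> = \<delta> + \<gamma> then lookup p \<alpha> else 0)"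
    by (simp add: lookup_sum lookup_single when_def)
  also have "\<dots> = (\<Sum>\<alpha>\<in>keys p. if \<alpha> = \<gamma> then lookup p \<alpha> else 0)"
    by (intro sum.cong refl if_cong) (simp add: add.commute[of _ \<delta>])
  also have "\<dots> = lookup p \<gamma>"
    by (auto simp: in_keys_iff)
  finally show ?thesis .
qed

lemma keys_mult_single:
  fixes p :: rpoly
  assumes "\<beta> \<in> keys (p * single \<delta> 1)"
  obtains \<gamma> where "\<gamma> \<in> keys p" "\<beta> = \<delta> + \<gamma>"
  using assms keys_mult[of p "single \<delta> 1"] by (auto simp: add.commute split: if_splits)

text \<open>Parity: in each coordinate \<open>\<alpha>\<close> is the quotient and
  \<open>\<gamma>\<close> the remainder of one division by 2.\<close>

lemma double_add_multilinear_eq_iff: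
  fixes \<alpha> \<alpha>' \<gamma> \<gamma>' :: multi_index
  assumes "\<And>i. lookup \<gamma> i \<le> 1" "\<And>i. lookup \<gamma>' i \<le> 1"
  shows "\<alpha> + \<alpha> + \<gamma> = \<alpha>' + \<alpha>' + \<gamma>' \<longleftrightarrow> \<alpha> = \<alpha>' \<and> \<gamma> = \<gamma>'"
proof
  assume eq: "\<alpha> + \<alpha> + \<gamma> = \<alpha>' + \<alpha>' + \<gamma>'"
  have "lookup \<alpha> i = lookup \<alpha>' i \<and> lookup \<gamma> i = lookup \<gamma>' i" for i
  proof -
    have "2 * lookup \<alpha> i + lookup \<gamma> i = 2 * lookup \<alpha>' i + lookup \<gamma>' i"
      using arg_cong[OF eq, of "\<lambda>m. lookup m i"] by (simp add: lookup_add)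
    then show ?thesis using assms[of i] by presburger
  qed
  then show "\<alpha> = \<alpha>' \<and> \<gamma> = \<gamma>'" by (auto intro: poly_mapping_eqI)
qed auto

text \<open>By parity of exponents only the summand of \<open>\<alpha>\<close> can contain the
  monomial \<open>\<alpha> + \<alpha> + \<gamma>\<close>, so nothing cancels between summands. The
  coefficients of \<open>F \<alpha>\<close> are thus dictated by \<open>f\<close>, which yields
  uniqueness.\<close>

lemma lookup_multilinear_decomposition:
  assumes dec: "multilinear_decomposition n d f F"
    and \<alpha>: "\<alpha> \<in> multi_indices n (d div 2)" and \<gamma>: "\<And>i. lookup \<gamma> i \<le> 1"
  shows "lookup (F \<alpha>) \<gamma> = lookup f (\<alpha> + \<alpha> + \<gamma>)"
proof -
  let ?I = "multi_indices n (d div 2)"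
  have ml: "multilinear (F \<alpha>')" if "\<alpha>' \<in> ?I" for \<alpha>'
    using dec that by (auto simp: multilinear_decomposition_def)
  have "lookup f (\<alpha> + \<alpha> + \<gamma>)
      = (\<Sum>\<alpha>'\<in>?I. lookup (F \<alpha>' * single (\<alpha>' + \<alpha>') 1) (\<alpha> + \<alpha> + \<gamma>))"
    using dec by (simp add: multilinear_decomposition_def lookup_sum)
  also have "\<dots> = (\<Sum>\<alpha>'\<in>?I. if \<alpha>' = \<alpha> then lookup (F \<alpha>) \<gamma> else 0)"
  proof (intro sum.cong refl)
    fix \<alpha>' assume \<alpha>': "\<alpha>' \<in> ?I"
    show "lookup (F \<alpha>' * single (\<alpha>' + \<alpha>') 1) (\<alpha> + \<alpha> + \<gamma>)
        = (if \<alpha>' = \<alpha> then lookup (F \<alpha>) \<gamma> else 0)"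
    proof (cases "\<alpha>' = \<alpha>")
      case True
      then show ?thesis using lookup_mult_single_add by simp
    next
      case False
      have "\<alpha> + \<alpha> + \<gamma> \<notin> keys (F \<alpha>' * single (\<alpha>' + \<alpha>') 1)"
      proof
        assume "\<alpha> + \<alpha> + \<gamma> \<in> keys (F \<alpha>' * single (\<alpha>' + \<alpha>') 1)"
        then obtain \<gamma>' where \<gamma>': "\<gamma>' \<in> keys (F \<alpha>')" "\<alpha> + \<alpha> + \<gamma> = \<alpha>' + \<alpha>' + \<gamma>'"
          by (rule keys_mult_single)
        have "\<And>i. lookup \<gamma>' i \<le> 1"
          using ml[OF \<alpha>'] \<gamma>' by (auto simp: multilinear_def)
        then show False
          using double_add_multilinear_eq_iff[of \<gamma> \<gamma>' \<alpha> \<alpha>'] \<gamma> \<gamma>' False by auto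
      qed
      then show ?thesis using False by (simp add: in_keys_iff)
    qed
  qed
  also have "\<dots> = lookup (F \<alpha>) \<gamma>"
    using \<alpha> by (simp add: finite_multi_indices)
  finally show ?thesis by simp
qed

lemma multilinear_decomposition_unique:
  assumes F: "multilinear_decomposition n d f F" and G: "multilinear_decomposition n d f G"
  shows "F = G"
proof
  fix \<alpha>
  show "F \<alpha> = G \<alpha>"
  proof (cases "\<alpha> \<in> multi_indices n (d div 2)")
    case False
    then show ?thesis using F G by (simp add: multilinear_decomposition_def)
  next
    case True
    then have ml: "multilinear (F \<alpha>)" "multilinear (G \<alpha>)"
      using F G by (auto simp: multilinear_decomposition_def)
    show ?thesis
    proof (rule poly_mapping_eqI)
      fix \<gamma>
      show "lookup (F \<alpha>) \<gamma> = lookup (G \<alpha>) \<gamma>"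
      proof (cases "\<forall>i. lookup \<gamma> i \<le> 1")
        case True
        then show ?thesis
          using lookup_multilinear_decomposition[OF F \<open>\<alpha> \<in> _\<close>]
            lookup_multilinear_decomposition[OF G \<open>\<alpha> \<in> _\<close>] by simp
      next
        case False
        then have "\<gamma> \<notin> keys (F \<alpha>)" "\<gamma> \<notin> keys (G \<alpha>)"
          using ml by (auto simp: multilinear_def)
        then show ?thesis by (simp add: in_keys_iff)
      qed
    qed
  qed
qed

text \<open>With \<open>odd_index\<close> this is division with remainder by 2 in every exponent; it
  sends a monomial to the summand it belongs to. \<open>Poly_Mapping.map\<close> keeps zero
  exponents at zero, in agreement with \<open>0 div 2\<close> and \<open>0 mod 2\<close>.\<close>

definition half_index :: "multi_index \<Rightarrow> multi_index" where
  "half_index \<beta> = Poly_Mapping.map (\<lambda>k. k div 2) \<beta>"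

definition odd_index :: "multi_index \<Rightarrow> multi_index" where
  "odd_index \<beta> = Poly_Mapping.map (\<lambda>k. k mod 2) \<beta>"

lemma lookup_half_index: "lookup (half_index \<beta>) i = lookup \<beta> i div 2"
  by (simp add: half_index_def Poly_Mapping.map.rep_eq when_def)

lemma lookup_odd_index: "lookup (odd_index \<beta>) i = lookup \<beta> i mod 2"
  by (simp add: odd_index_def Poly_Mapping.map.rep_eq when_def)

lemma half_odd_index: "half_index \<beta> + half_index \<beta> + odd_index \<beta> = \<beta>"
proof (rule poly_mapping_eqI)
  fix i
  show "lookup (half_index \<beta> + half_index \<beta> + odd_index \<beta>) i = lookup \<beta> i"
    unfolding lookup_add lookup_half_index lookup_odd_index by presburger
qed

text \<open>The monomials of \<open>f\<close> are sorted by \<open>half_index\<close>; what remains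
  of each is its \<open>odd_index\<close>, whose exponents are at most 1.\<close>

lemma multilinear_decomposition_exists:
  assumes var: "variate n f" and hom: "homogeneous d f"
  shows "\<exists>F. multilinear_decomposition n d f F"
proof -
  define F where "F \<alpha> = (\<Sum>\<beta>\<in>{\<beta>\<in>keys f. half_index \<beta> = \<alpha>}. single (odd_index \<beta>) (lookup f \<beta>))"
    for \<alpha>
  let ?I = "multi_indices n (d div 2)"
  have half_I: "half_index \<beta> \<in> ?I" if "\<beta> \<in> keys f" for \<beta>
  proof -
    have "mdeg \<beta> = 2 * mdeg (half_index \<beta>) + mdeg (odd_index \<beta>)"
      by (metis half_odd_index mdeg_add mult_2)
    moreover have "mdeg \<beta> = d" using hom that by (auto simp: homogeneous_def)
    moreover have "keys (half_index \<beta>) \<subseteq> keys \<beta>"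
      by (auto simp: in_keys_iff lookup_half_index)
    ultimately show ?thesis
      using var that by (fastforce simp: multi_indices_def variate_def)
  qed
  have keysF: "\<exists>\<beta>\<in>keys f. half_index \<beta> = \<alpha> \<and> \<gamma> = odd_index \<beta>" if "\<gamma> \<in> keys (F \<alpha>)" for \<alpha> \<gamma>
    using that keys_sum[of "\<lambda>\<beta>. single (odd_index \<beta>) (lookup f \<beta>)" "{\<beta>\<in>keys f. half_index \<beta> = \<alpha>}"]
    unfolding F_def by (fastforce split: if_splits)
  have "variate n (F \<alpha>)" for \<alpha>
  proof -
    have "keys (odd_index \<beta>) \<subseteq> keys \<beta>" for \<beta>
      by (auto simp: in_keys_iff lookup_odd_index intro: ccontr)
    then show ?thesis using keysF var unfolding variate_def by blast
  qed
  moreover have "homogeneous (d - 2 * mdeg \<alpha>) (F \<alpha>)" for \<alpha>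
    unfolding homogeneous_def
  proof
    fix \<gamma> assume "\<gamma> \<in> keys (F \<alpha>)"
    then obtain \<beta> where \<beta>: "\<beta> \<in> keys f" "half_index \<beta> = \<alpha>" "\<gamma> = odd_index \<beta>"
      using keysF by blast
    have "mdeg \<beta> = 2 * mdeg (half_index \<beta>) + mdeg (odd_index \<beta>)"
      by (metis half_odd_index mdeg_add mult_2)
    moreover have "mdeg \<beta> = d" using hom \<beta> by (auto simp: homogeneous_def)
    ultimately show "mdeg \<gamma> = d - 2 * mdeg \<alpha>" using \<beta> by simp
  qed
  moreover have "multilinear (F \<alpha>)" for \<alpha>
    using keysF by (fastforce simp: multilinear_def lookup_odd_index)
  moreover have "f = (\<Sum>\<alpha>\<in>?I. F \<alpha> * single (\<alpha> + \<alpha>) 1)"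
  proof -
    have "F \<alpha> * single (\<alpha> + \<alpha>) 1
        = (\<Sum>\<beta>\<in>{\<beta>\<in>keys f. half_index \<beta> = \<alpha>}. single \<beta> (lookup f \<beta>))" for \<alpha>
      unfolding F_def sum_distrib_right
    proof (intro sum.cong refl)
      fix \<beta> assume "\<beta> \<in> {\<beta>\<in>keys f. half_index \<beta> = \<alpha>}"
      then have "odd_index \<beta> + (\<alpha> + \<alpha>) = \<beta>"
        using half_odd_index[of \<beta>] by (simp add: add.commute)
      then show "single (odd_index \<beta>) (lookup f \<beta>) * single (\<alpha> + \<alpha>) 1 = single \<beta> (lookup f \<beta>)"
        by (simp add: mult_single)
    qed
    then have "(\<Sum>\<alpha>\<in>?I. F \<alpha> * single (\<alpha> + \<alpha>) 1) = (\<Sum>\<beta>\<in>keys f. single \<beta> (lookup f \<beta>))"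
      using half_I by (subst sum.group[symmetric, of _ ?I half_index])
        (auto simp: finite_multi_indices)
    then show ?thesis using poly_eq_sum_single[of f] by simp
  qed
  moreover have "F \<alpha> = 0" if "\<alpha> \<notin> ?I" for \<alpha>
    using half_I that unfolding F_def by (intro sum.neutral) auto
  ultimately show ?thesis unfolding multilinear_decomposition_def by blast
qed

section \<open>Matrix representations\<close>

lemma finite_tuples [simp]: "finite (tuples n k)"
  unfolding tuples_def using finite_lists_length_eq[of "{..<n}" k] by simp

text \<open>The link between tensor coordinates and monomials: the entry of a tensor power at
  \<open>L\<close> is the monomial with exponent \<open>index_of L\<close>.\<close>

primrec index_of :: "nat list \<Rightarrow> multi_index" where
  "index_of [] = 0"
| "index_of (i # L) = single i 1 + index_of L"

lemma lookup_index_of: "lookup (index_of L) i = count (mset L) i"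
  by (induction L) (auto simp: lookup_add lookup_single when_def)

lemma keys_index_of [simp]: "keys (index_of L) = set L"
proof (intro set_eqI)
  fix i
  have "lookup (index_of L) i \<noteq> 0 \<longleftrightarrow> i \<in> set L"
    by (simp add: lookup_index_of)
  then show "i \<in> keys (index_of L) \<longleftrightarrow> i \<in> set L"
    by (simp add: in_keys_iff)
qed

lemma mdeg_index_of [simp]: "mdeg (index_of L) = length L"
  by (induction L) (simp_all add: mdeg_add)

lemma monom_val_index_of: "monom_val (index_of L) x = tensor_power x L"
  by (induction L) (simp_all add: tensor_power_def monom_val_add)

text \<open>The cardinality of this set is the multinomial coefficient of
  \<open>\<alpha>\<close>.\<close>

definition arrangements :: "multi_index \<Rightarrow> nat list set" where
  "arrangements \<alpha> = {L. index_of L = \<alpha>}"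

definition multiset_of_index :: "multi_index \<Rightarrow> nat multiset" where
  "multiset_of_index \<alpha> = (\<Sum>i\<in>keys \<alpha>. replicate_mset (lookup \<alpha> i) i)"

lemma count_multiset_of_index: "count (multiset_of_index \<alpha>) i = lookup \<alpha> i"
  by (auto simp: multiset_of_index_def count_sum in_keys_iff)

lemma arrangements_eq_permutations: "arrangements \<alpha> = permutations_of_multiset (multiset_of_index \<alpha>)"
  unfolding arrangements_def permutations_of_multiset_def
  by (auto simp: multiset_eq_iff poly_mapping_eq_iff fun_eq_iff lookup_index_of count_multiset_of_index)

lemma finite_arrangements [simp]: "finite (arrangements \<alpha>)"
  by (simp add: arrangements_eq_permutations)

lemma arrangements_not_empty: "arrangements \<alpha> \<noteq> {}"
  by (simp add: arrangements_eq_permutations)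

lemma card_arrangements_pos: "0 < card (arrangements \<alpha>)"
  by (simp add: card_gt_0_iff arrangements_not_empty)

lemma card_arrangements:
  "card (arrangements \<alpha>) * (\<Prod>i\<in>keys \<alpha>. fact (lookup \<alpha> i)) = fact (mdeg \<alpha>)"
proof -
  have "set_mset (multiset_of_index \<alpha>) = keys \<alpha>"
    by (auto simp: set_mset_def count_multiset_of_index in_keys_iff)
  then show ?thesis
    using card_permutations_of_multiset_aux[of "multiset_of_index \<alpha>"]
    by (simp add: arrangements_eq_permutations count_multiset_of_index
        size_multiset_overloaded_eq mdeg_def)
qed

section \<open>Quadratic forms indexed by tuples, and their suprema over the unit sphere\<close>

lemma quad_form_sum:
  "quad_form n k (\<lambda>I J. \<Sum>b\<in>S. g b I J) z = (\<Sum>b\<in>S. quad_form n k (g b) z)"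
proof -
  have "quad_form n k (\<lambda>I J. \<Sum>b\<in>S. g b I J) z
      = (\<Sum>I\<in>tuples n k. \<Sum>J\<in>tuples n k. \<Sum>b\<in>S. z I * g b I J * z J)"
    by (simp add: quad_form_def sum_distrib_left sum_distrib_right)
  also have "\<dots> = (\<Sum>I\<in>tuples n k. \<Sum>b\<in>S. \<Sum>J\<in>tuples n k. z I * g b I J * z J)"
    by (intro sum.cong refl sum.swap)
  also have "\<dots> = (\<Sum>b\<in>S. \<Sum>I\<in>tuples n k. \<Sum>J\<in>tuples n k. z I * g b I J * z J)"
    by (rule sum.swap)
  finally show ?thesis by (simp add: quad_form_def)
qed

lemma quad_form_divide: "quad_form n k (\<lambda>I J. M I J / c) z = quad_form n k M z / c"
  by (simp add: quad_form_def sum_divide_distrib)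

lemma quad_form_scale: "quad_form n k M (\<lambda>I. c * z I) = c\<^sup>2 * quad_form n k M z"
  by (simp add: quad_form_def sum_distrib_left power2_eq_square algebra_simps)

text \<open>A quadratic form is homogeneous of degree 2. The vectors of later interest are slices of
  a unit vector, which are not normalized and may vanish.\<close>

lemma quad_form_le_scaled:
  assumes B: "\<And>z. L2_set z (tuples n k) = 1 \<Longrightarrow> quad_form n k M z \<le> B"
  shows "quad_form n k M z \<le> B * (L2_set z (tuples n k))\<^sup>2"
proof (cases "L2_set z (tuples n k) = 0")
  case True
  then have "\<And>I. I \<in> tuples n k \<Longrightarrow> z I = 0"
    by (simp add: L2_set_eq_0_iff)
  then show ?thesis using True by (simp add: quad_form_def)
next
  case False
  define r where "r = L2_set z (tuples n k)"
  have r: "r > 0" using False L2_set_nonneg[of z "tuples n k"] by (simp add: r_def less_le)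
  have "L2_set (\<lambda>I. inverse r * z I) (tuples n k) = 1"
    using r by (subst L2_set_right_distrib[symmetric]) (auto simp: r_def)
  then have "quad_form n k M (\<lambda>I. inverse r * z I) \<le> B" by (rule B)
  then show ?thesis
    using r unfolding quad_form_scale r_def[symmetric] by (simp add: field_simps power2_eq_square)
qed

lemma abs_le_L2_set:
  assumes "finite A" "i \<in> A"
  shows "\<bar>f i\<bar> \<le> L2_set f A"
  using member_le_L2_set[OF assms, of "\<lambda>i. \<bar>f i\<bar>"] by (simp add: L2_set_def)

text \<open>A real supremum carries information only for bounded sets. Entries of a unit vector are
  at most 1 in modulus, so the sum of the moduli of the matrix entries is a bound.\<close>

lemma bdd_above_quad_form:
  "bdd_above ((\<lambda>z. quad_form n k M z) ` {z. L2_set z (tuples n k) = 1})"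
proof (rule bdd_aboveI2)
  fix z assume "z \<in> {z. L2_set z (tuples n k) = 1}"
  then have z: "\<bar>z I\<bar> \<le> 1" if "I \<in> tuples n k" for I
    using abs_le_L2_set[of "tuples n k" I z] that by simp
  show "quad_form n k M z \<le> (\<Sum>I\<in>tuples n k. \<Sum>J\<in>tuples n k. \<bar>M I J\<bar>)"
    unfolding quad_form_def
  proof (intro sum_mono)
    fix I J assume IJ: "I \<in> tuples n k" "J \<in> tuples n k"
    have "\<bar>z I * M I J * z J\<bar> = \<bar>z I\<bar> * \<bar>z J\<bar> * \<bar>M I J\<bar>" by (simp add: abs_mult)
    also have "\<dots> \<le> 1 * \<bar>M I J\<bar>"
      using z[OF IJ(1)] z[OF IJ(2)] by (intro mult_right_mono mult_le_one) auto
    finally show "z I * M I J * z J \<le> \<bar>M I J\<bar>" by simp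
  qed
qed

text \<open>A fixed unit vector, showing that spheres are nonempty for \<open>n \<ge> 1\<close>. Its
  tensor powers are again standard basis vectors, so evaluation at it bounds \<open>Lambda\<close>
  from below.\<close>

definition basis_vec :: "nat \<Rightarrow> real" where
  "basis_vec i = (if i = 0 then 1 else 0)"

lemma tensor_power_basis_vec:
  "tensor_power basis_vec I = (if I = replicate (length I) 0 then 1 else 0)"
  by (induction I) (auto simp: tensor_power_def basis_vec_def)

lemma L2_set_basis_vec:
  assumes "n \<ge> 1"
  shows "L2_set basis_vec {..<n} = 1"
proof -
  have "(\<Sum>i<n. (basis_vec i)\<^sup>2) = (\<Sum>i<n. if i = 0 then 1 else 0)"
    by (intro sum.cong) (auto simp: basis_vec_def)
  also have "\<dots> = 1" using assms by simp
  finally show ?thesis by (simp add: L2_set_def)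
qed

lemma L2_set_tensor_power_basis_vec:
  assumes "n \<ge> 1"
  shows "L2_set (tensor_power basis_vec) (tuples n k) = 1"
proof -
  have "replicate k 0 \<in> tuples n k" using assms by (auto simp: tuples_def)
  moreover have "(\<Sum>I\<in>tuples n k. (tensor_power basis_vec I)\<^sup>2)
      = (\<Sum>I\<in>tuples n k. if I = replicate k 0 then 1 else 0)"
    by (intro sum.cong) (auto simp: tensor_power_basis_vec tuples_def)
  ultimately show ?thesis by (simp add: L2_set_def)
qed

lemma peval_basis_vec_le_SUP:
  assumes "n \<ge> 1" "matrix_rep n t h M"
  shows "peval h basis_vec
    \<le> (SUP z\<in>{z. L2_set z (tuples n (t div 2)) = 1}. quad_form n (t div 2) M z)"
proof -
  have "quad_form n (t div 2) M (tensor_power basis_vec) = peval h basis_vec"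
    using assms(2) by (simp add: matrix_rep_def)
  then show ?thesis
    using cSUP_upper[OF _ bdd_above_quad_form, of "tensor_power basis_vec" n "t div 2" M]
      L2_set_tensor_power_basis_vec[OF assms(1)] by simp
qed

text \<open>A real infimum is known to lie below its members once the set is bounded below; the
  value of \<open>h\<close> at \<open>basis_vec\<close> is a lower bound common to all
  representations.\<close>

lemma Lambda_le:
  assumes n: "n \<ge> 1" and M: "matrix_rep n t h M"
    and B: "\<And>z. L2_set z (tuples n (t div 2)) = 1 \<Longrightarrow> quad_form n (t div 2) M z \<le> B"
  shows "Lambda n t h \<le> B"
  unfolding Lambda_def
proof (rule cINF_lower2)
  show "bdd_below ((\<lambda>M. SUP z\<in>{z. L2_set z (tuples n (t div 2)) = 1}. quad_form n (t div 2) M z)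
      ` {M. matrix_rep n t h M})"
    using peval_basis_vec_le_SUP[OF n] by (intro bdd_belowI2) auto
  show "(SUP z\<in>{z. L2_set z (tuples n (t div 2)) = 1}. quad_form n (t div 2) M z) \<le> B"
    using B L2_set_tensor_power_basis_vec[OF n] by (intro cSUP_least) auto
qed (use M in simp)

text \<open>The infimum in \<open>Lambda\<close> is not shown to be attained, so a representation is
  extracted with slack only. \<open>M0\<close> ensures that the infimum is over a nonempty
  set.\<close>

lemma Lambda_less_obtains:
  assumes "Lambda n t h < c" and rep: "matrix_rep n t h M0"
  obtains M where "matrix_rep n t h M"
    "\<And>z. L2_set z (tuples n (t div 2)) = 1 \<Longrightarrow> quad_form n (t div 2) M z \<le> c"
proof -
  have "\<exists>M. matrix_rep n t h M \<and>
      (SUP z\<in>{z. L2_set z (tuples n (t div 2)) = 1}. quad_form n (t div 2) M z) < c"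
    using cInf_lessD[OF _ assms(1)[unfolded Lambda_def]] rep by auto
  then obtain M where M: "matrix_rep n t h M"
    "(SUP z\<in>{z. L2_set z (tuples n (t div 2)) = 1}. quad_form n (t div 2) M z) < c"
    by blast
  show thesis
  proof (rule that[OF M(1)])
    fix z assume "L2_set z (tuples n (t div 2)) = 1"
    then have "quad_form n (t div 2) M z
        \<le> (SUP z\<in>{z. L2_set z (tuples n (t div 2)) = 1}. quad_form n (t div 2) M z)"
      by (intro cSUP_upper bdd_above_quad_form) simp
    then show "quad_form n (t div 2) M z \<le> c" using M(2) by simp
  qed
qed

lemma peval_basis_vec_le_Lambda:
  assumes "n \<ge> 1" "matrix_rep n t h M"
  shows "peval h basis_vec \<le> Lambda n t h"
  unfolding Lambda_def
  using assms peval_basis_vec_le_SUP by (intro cINF_greatest) auto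

text \<open>An ordering of the variables of each monomial is cut into a row index and a column index
  of equal length. Half of the coefficient goes to this entry and half to its transpose.\<close>

lemma matrix_rep_exists:
  assumes var: "variate n h" and hom: "homogeneous t h" and "even t"
  shows "\<exists>M. matrix_rep n t h M"
proof -
  define k where "k = t div 2"
  have t: "t = k + k" using \<open>even t\<close> by (auto simp: k_def)
  define L where "L \<beta> = (SOME L. L \<in> arrangements \<beta>)" for \<beta>
  have L: "index_of (L \<beta>) = \<beta>" for \<beta>
    using some_in_eq[of "arrangements \<beta>"] arrangements_not_empty[of \<beta>]
    by (simp add: L_def arrangements_def)
  define A where "A \<beta> = take k (L \<beta>)" for \<beta>
  define B where "B \<beta> = drop k (L \<beta>)" for \<beta>
  \<comment> \<open>The halves are added rather than put into one case distinction: if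
    \<open>A \<beta> = B \<beta>\<close>, both fall on the same diagonal entry and must yield the
    whole coefficient.\<close>
  define g where "g \<beta> I J = (if I = A \<beta> \<and> J = B \<beta> then lookup h \<beta> / 2 else 0)
      + (if I = B \<beta> \<and> J = A \<beta> then lookup h \<beta> / 2 else 0)" for \<beta> I J
  have AB: "A \<beta> \<in> tuples n k" "B \<beta> \<in> tuples n k" if "\<beta> \<in> keys h" for \<beta>
  proof -
    have "set (L \<beta>) \<subseteq> {..<n}"
      using var that keys_index_of[of "L \<beta>"] by (auto simp: variate_def L)
    moreover have "length (L \<beta>) = k + k"
      using hom that mdeg_index_of[of "L \<beta>"] by (auto simp: homogeneous_def L t)
    ultimately show "A \<beta> \<in> tuples n k" "B \<beta> \<in> tuples n k"
      by (auto simp: A_def B_def tuples_def dest: in_set_takeD in_set_dropD)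
  qed
  have delta: "(\<Sum>I\<in>tuples n k. \<Sum>J\<in>tuples n k. z I * (if I = P \<and> J = Q then c else 0) * z J)
      = c * z P * z Q" if "P \<in> tuples n k" "Q \<in> tuples n k" for P Q c and z :: "nat list \<Rightarrow> real"
  proof -
    have "(\<Sum>I\<in>tuples n k. \<Sum>J\<in>tuples n k. z I * (if I = P \<and> J = Q then c else 0) * z J)
        = (\<Sum>I\<in>tuples n k. \<Sum>J\<in>tuples n k. if I = P then if J = Q then c * z P * z Q else 0 else 0)"
      by (intro sum.cong refl) auto
    also have "\<dots> = (\<Sum>I\<in>tuples n k. if I = P then \<Sum>J\<in>tuples n k. if J = Q then c * z P * z Q else 0 else 0)"
      by (intro sum.cong refl) auto
    finally show ?thesis using that by simp
  qed
  have q: "quad_form n k (g \<beta>) z = lookup h \<beta> * z (A \<beta>) * z (B \<beta>)" if "\<beta> \<in> keys h" for \<beta> z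
    using AB[OF that]
    by (simp add: quad_form_def g_def distrib_left distrib_right sum.distrib delta)
  have "quad_form n k (\<lambda>I J. \<Sum>\<beta>\<in>keys h. g \<beta> I J) (tensor_power x) = peval h x" for x
  proof -
    have "tensor_power x (A \<beta>) * tensor_power x (B \<beta>) = monom_val \<beta> x" for \<beta>
    proof -
      have "tensor_power x (A \<beta>) * tensor_power x (B \<beta>) = tensor_power x (A \<beta> @ B \<beta>)"
        by (simp add: tensor_power_def)
      then show ?thesis by (simp add: A_def B_def L flip: monom_val_index_of)
    qed
    then show ?thesis
      by (simp add: quad_form_sum q peval_eq_poly_val poly_val_def mult.assoc)
  qed
  moreover have "(\<Sum>\<beta>\<in>keys h. g \<beta> I J) = (\<Sum>\<beta>\<in>keys h. g \<beta> J I)" for I J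
    by (intro sum.cong refl) (simp add: g_def add.commute conj_commute)
  ultimately have "matrix_rep n t h (\<lambda>I J. \<Sum>\<beta>\<in>keys h. g \<beta> I J)"
    unfolding matrix_rep_def k_def[symmetric] by blast
  then show ?thesis by blast
qed

section \<open>Block diagonal forms and the upper bound for \<open>Lambda\<close>\<close>

lemma sum_tuples_split:
  assumes "k \<le> m"
  shows "(\<Sum>I\<in>tuples n m. g (take k I) (drop k I)) = (\<Sum>P\<in>tuples n k. \<Sum>I\<in>tuples n (m - k). g P I)"
proof -
  have "(\<Sum>I\<in>tuples n m. g (take k I) (drop k I))
      = (\<Sum>(P, I)\<in>tuples n k \<times> tuples n (m - k). g P I)"
    using assms
    by (intro sum.reindex_bij_witness[of _ "\<lambda>(P, I). P @ I" "\<lambda>I. (take k I, drop k I)"])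
      (auto simp: tuples_def dest: in_set_takeD in_set_dropD)
  then show ?thesis by (simp add: sum.cartesian_product)
qed

text \<open>The first \<open>k\<close> entries of a tuple name its block, the others its position
  inside. Entries joining different blocks vanish, so the form acts separately on each slice of
  \<open>z\<close>.\<close>

lemma quad_form_block_diagonal:
  assumes "k \<le> m"
  shows "quad_form n m (\<lambda>I J. if take k I = take k J then N (take k I) (drop k I) (drop k J) else 0) z
    = (\<Sum>P\<in>tuples n k. quad_form n (m - k) (N P) (\<lambda>I. z (P @ I)))"
proof -
  let ?T = "tuples n k" and ?S = "tuples n (m - k)"
  define g where "g P I Q J = (if P = Q then z (P @ I) * N P I J * z (Q @ J) else 0)" for P I Q J
  have "quad_form n m (\<lambda>I J. if take k I = take k J then N (take k I) (drop k I) (drop k J) else 0) z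
      = (\<Sum>I\<in>tuples n m. \<Sum>J\<in>tuples n m. g (take k I) (drop k I) (take k J) (drop k J))"
    unfolding quad_form_def g_def append_take_drop_id
    by (intro sum.cong refl) simp
  also have "\<dots> = (\<Sum>I\<in>tuples n m. \<Sum>Q\<in>?T. \<Sum>J\<in>?S. g (take k I) (drop k I) Q J)"
  proof (rule sum.cong[OF refl])
    fix I
    show "(\<Sum>J\<in>tuples n m. g (take k I) (drop k I) (take k J) (drop k J))
        = (\<Sum>Q\<in>?T. \<Sum>J\<in>?S. g (take k I) (drop k I) Q J)"
      by (fact sum_tuples_split[OF assms, of "g (take k I) (drop k I)" n])
  qed
  also have "\<dots> = (\<Sum>P\<in>?T. \<Sum>I\<in>?S. \<Sum>Q\<in>?T. \<Sum>J\<in>?S. g P I Q J)"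
    by (fact sum_tuples_split[OF assms, of "\<lambda>P I. \<Sum>Q\<in>?T. \<Sum>J\<in>?S. g P I Q J" n])
  also have "\<dots> = (\<Sum>P\<in>?T. \<Sum>I\<in>?S. \<Sum>J\<in>?S. z (P @ I) * N P I J * z (P @ J))"
  proof ((rule sum.cong[OF refl])+)
    fix P I assume "P \<in> ?T"
    have "(\<Sum>Q\<in>?T. \<Sum>J\<in>?S. g P I Q J)
        = (\<Sum>Q\<in>?T. if P = Q then \<Sum>J\<in>?S. z (P @ I) * N P I J * z (P @ J) else 0)"
      unfolding g_def by (rule sum.cong[OF refl]) simp
    then show "(\<Sum>Q\<in>?T. \<Sum>J\<in>?S. g P I Q J) = (\<Sum>J\<in>?S. z (P @ I) * N P I J * z (P @ J))"
      using \<open>P \<in> ?T\<close> by simp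
  qed
  finally show ?thesis by (simp add: quad_form_def)
qed

text \<open>Each \<open>\<alpha>\<close> of degree \<open>k\<close> comes from exactly as many
  tuples of length \<open>k\<close> as the weight divides by.\<close>

lemma sum_tuples_index_of:
  "(\<Sum>k\<le>m. \<Sum>P\<in>tuples n k. g (index_of P) / card (arrangements (index_of P)))
    = (\<Sum>\<alpha>\<in>multi_indices n m. g \<alpha> :: real)"
proof -
  define S where "S = (SIGMA k:{..m}. tuples n k)"
  have "(\<Sum>k\<le>m. \<Sum>P\<in>tuples n k. g (index_of P) / card (arrangements (index_of P)))
      = (\<Sum>x\<in>S. g (index_of (snd x)) / card (arrangements (index_of (snd x))))"
    by (simp add: S_def sum.Sigma case_prod_beta)
  also have "\<dots> = (\<Sum>\<alpha>\<in>multi_indices n m. \<Sum>x\<in>{x\<in>S. index_of (snd x) = \<alpha>}.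
      g (index_of (snd x)) / card (arrangements (index_of (snd x))))"
    by (intro sum.group[symmetric] finite_multi_indices)
      (simp add: S_def, auto simp: S_def tuples_def multi_indices_def)
  also have "\<dots> = (\<Sum>\<alpha>\<in>multi_indices n m. g \<alpha>)"
  proof (intro sum.cong refl)
    fix \<alpha> assume "\<alpha> \<in> multi_indices n m"
    \<comment> \<open>The degree of \<open>\<alpha>\<close> forces the length of \<open>P\<close>,
      so tagging tuples by their length makes no copies.\<close>
    then have "{x\<in>S. index_of (snd x) = \<alpha>} = (\<lambda>P. (length P, P)) ` arrangements \<alpha>"
      by (auto simp: S_def tuples_def multi_indices_def arrangements_def)
    then have "card {x\<in>S. index_of (snd x) = \<alpha>} = card (arrangements \<alpha>)"
      by (simp add: card_image inj_on_def)
    then show "(\<Sum>x\<in>{x\<in>S. index_of (snd x) = \<alpha>}.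
        g (index_of (snd x)) / card (arrangements (index_of (snd x)))) = g \<alpha>"
      using arrangements_not_empty[of \<alpha>] by simp
  qed
  finally show ?thesis .
qed

lemma poly_val_multilinear_decomposition:
  assumes "multilinear_decomposition n d f F"
  shows "poly_val f x = (\<Sum>\<alpha>\<in>multi_indices n (d div 2). poly_val (F \<alpha>) x * monom_val (\<alpha> + \<alpha>) x)"
proof -
  have "f = (\<Sum>\<alpha>\<in>multi_indices n (d div 2). F \<alpha> * single (\<alpha> + \<alpha>) 1)"
    using assms by (simp add: multilinear_decomposition_def)
  then have "poly_val f x = poly_val (\<Sum>\<alpha>\<in>multi_indices n (d div 2). F \<alpha> * single (\<alpha> + \<alpha>) 1) x"
    by simp
  then show ?thesis by (simp add: poly_val_sum poly_val_mult_single)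
qed

text \<open>Spreading the summand of \<open>\<alpha>\<close> evenly over the arrangements of
  \<open>\<alpha>\<close> puts it into blocks, each with bound \<open>B\<close>. For fixed
  \<open>k\<close> the blocks act on disjoint slices, so their bounds do not add; the factor
  \<open>d div 2 + 1\<close> counts the values of \<open>k\<close>.\<close>

lemma Lambda_le_multilinear_decomposition:
  fixes B :: real
  assumes n: "n \<ge> 1" and dec: "multilinear_decomposition n d f F"
    and M: "\<And>\<alpha>. \<alpha> \<in> multi_indices n (d div 2) \<Longrightarrow> matrix_rep n (d - 2 * mdeg \<alpha>) (F \<alpha>) (M \<alpha>)"
    and B: "\<And>\<alpha> z. \<alpha> \<in> multi_indices n (d div 2) \<Longrightarrow> L2_set z (tuples n (d div 2 - mdeg \<alpha>)) = 1 \<Longrightarrow>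
      quad_form n (d div 2 - mdeg \<alpha>) (M \<alpha>) z \<le> B * card (arrangements \<alpha>)"
  shows "Lambda n d f \<le> real (d div 2 + 1) * B"
proof -
  define m where "m = d div 2"
  have half: "(d - 2 * j) div 2 = m - j" for j by (simp add: m_def)
  define N where "N P I J = M (index_of P) I J / card (arrangements (index_of P))" for P I J
  \<comment> \<open>Summand \<open>k\<close> carries all \<open>\<alpha>\<close> of degree
    \<open>k\<close>: its block \<open>P\<close> holds the weighted matrix of
    \<open>index_of P\<close>, acting on the remaining \<open>m - k\<close> positions.\<close>
  define W where "W I J =
      (\<Sum>k\<le>m. if take k I = take k J then N (take k I) (drop k I) (drop k J) else 0)" for I J
  have idx: "index_of P \<in> multi_indices n (d div 2)" if "P \<in> tuples n k" "k \<le> m" for P k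
    using that by (auto simp: tuples_def multi_indices_def m_def)
  have W: "quad_form n m W z
      = (\<Sum>k\<le>m. \<Sum>P\<in>tuples n k. quad_form n (m - k) (M (index_of P)) (\<lambda>I. z (P @ I))
          / card (arrangements (index_of P)))" for z
  proof -
    have N: "N P = (\<lambda>I J. M (index_of P) I J / card (arrangements (index_of P)))" for P
      by (simp add: N_def fun_eq_iff)
    have "quad_form n m W z = (\<Sum>k\<le>m. \<Sum>P\<in>tuples n k. quad_form n (m - k) (N P) (\<lambda>I. z (P @ I)))"
      unfolding W_def quad_form_sum by (intro sum.cong refl quad_form_block_diagonal) simp
    then show ?thesis unfolding N quad_form_divide .
  qed
  show ?thesis
  proof (rule Lambda_le[OF n])
    show "matrix_rep n d f W"
      unfolding matrix_rep_def m_def[symmetric]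
    proof (intro conjI ballI allI)
      fix I J assume IJ: "I \<in> tuples n m" "J \<in> tuples n m"
      have "N (take k I) (drop k I) (drop k J) = N (take k J) (drop k J) (drop k I)"
        if "k \<le> m" "take k I = take k J" for k
      proof -
        have P: "take k J \<in> tuples n k" "drop k I \<in> tuples n (m - k)" "drop k J \<in> tuples n (m - k)"
          using IJ that by (auto simp: tuples_def dest: in_set_takeD in_set_dropD)
        then have "length (take k J) = k" by (simp add: tuples_def)
        then have "M (index_of (take k J)) (drop k I) (drop k J)
            = M (index_of (take k J)) (drop k J) (drop k I)"
          using M[OF idx[OF P(1) that(1)]] P unfolding matrix_rep_def half mdeg_index_of by simp
        then show ?thesis using that by (simp add: N_def)
      qed
      then show "W I J = W J I" unfolding W_def by (intro sum.cong refl) (metis atMost_iff)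
    next
      fix x
      have "quad_form n (m - k) (M (index_of P)) (\<lambda>I. tensor_power x (P @ I))
          = poly_val (F (index_of P)) x * monom_val (index_of P + index_of P) x"
        if "P \<in> tuples n k" "k \<le> m" for k P
      proof -
        have "length P = k" using that by (simp add: tuples_def)
        then have "quad_form n (m - k) (M (index_of P)) (tensor_power x) = peval (F (index_of P)) x"
          using M[OF idx[OF that]] unfolding matrix_rep_def half mdeg_index_of by blast
        \<comment> \<open>Fixing the prefix \<open>P\<close> pulls out the scalar
          \<open>tensor_power x P\<close>, which the quadratic form squares to
          \<open>x ^ 2\<alpha>\<close> for \<open>\<alpha> = index_of P\<close>.\<close>
        moreover have "(\<lambda>I. tensor_power x (P @ I)) = (\<lambda>I. tensor_power x P * tensor_power x I)"
          by (simp add: tensor_power_def)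
        ultimately show ?thesis
          by (simp add: quad_form_scale peval_eq_poly_val monom_val_add monom_val_index_of
              power2_eq_square)
      qed
      then have "quad_form n m W (tensor_power x)
          = (\<Sum>k\<le>m. \<Sum>P\<in>tuples n k. poly_val (F (index_of P)) x * monom_val (index_of P + index_of P) x
              / card (arrangements (index_of P)))"
        unfolding W by (intro sum.cong refl) simp
      then show "quad_form n m W (tensor_power x) = peval f x"
        using sum_tuples_index_of[of "\<lambda>\<alpha>. poly_val (F \<alpha>) x * monom_val (\<alpha> + \<alpha>) x" n m]
        by (simp add: peval_eq_poly_val poly_val_multilinear_decomposition[OF dec] m_def)
    qed
  next
    fix z assume "L2_set z (tuples n (d div 2)) = 1"
    then have z: "(\<Sum>I\<in>tuples n m. (z I)\<^sup>2) = 1" by (simp add: L2_set_def m_def)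
    have "quad_form n m W z \<le> (\<Sum>k\<le>m. \<Sum>P\<in>tuples n k. B * (\<Sum>I\<in>tuples n (m - k). (z (P @ I))\<^sup>2))"
      unfolding W
    proof (intro sum_mono)
      fix k P assume k: "k \<in> {..m}" and P: "P \<in> tuples n k"
      then have I: "index_of P \<in> multi_indices n (d div 2)" by (intro idx) auto
      have "length P = k" using P by (simp add: tuples_def)
      then have "quad_form n (m - k) (M (index_of P)) (\<lambda>I. z (P @ I))
          \<le> B * card (arrangements (index_of P)) * (L2_set (\<lambda>I. z (P @ I)) (tuples n (m - k)))\<^sup>2"
        using B[OF I] by (intro quad_form_le_scaled) (simp add: m_def)
      then show "quad_form n (m - k) (M (index_of P)) (\<lambda>I. z (P @ I))
          / card (arrangements (index_of P)) \<le> B * (\<Sum>I\<in>tuples n (m - k). (z (P @ I))\<^sup>2)"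
        using card_arrangements_pos[of "index_of P"]
        by (simp add: L2_set_def sum_nonneg pos_divide_le_eq mult_ac)
    qed
    \<comment> \<open>For each \<open>k\<close> the slices partition the coordinates of
      \<open>z\<close>, so their squared norms add up to 1.\<close>
    also have "\<dots> = (\<Sum>k\<le>m. B)"
    proof (intro sum.cong refl)
      fix k assume "k \<in> {..m}"
      then have "(\<Sum>P\<in>tuples n k. \<Sum>I\<in>tuples n (m - k). (z (P @ I))\<^sup>2) = 1"
        using sum_tuples_split[of k m "\<lambda>P I. (z (P @ I))\<^sup>2" n] z by simp
      then show "(\<Sum>P\<in>tuples n k. B * (\<Sum>I\<in>tuples n (m - k). (z (P @ I))\<^sup>2)) = B"
        by (simp flip: sum_distrib_left)
    qed
    also have "\<dots> = real (d div 2 + 1) * B" by (simp add: m_def algebra_simps)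
    finally show "quad_form n (d div 2) W z \<le> real (d div 2 + 1) * B" by (simp add: m_def)
  qed
qed

section \<open>Norms of the multilinear parts\<close>

text \<open>The zero vector has no direction of its own; \<open>basis_vec\<close> stands in for
  it.\<close>

lemma sphere_parametrization:
  fixes x :: "nat \<Rightarrow> real"
  assumes "n \<ge> 1"
  obtains u where "L2_set u {..<n} = 1" "\<And>i. i < n \<Longrightarrow> x i = L2_set x {..<n} * u i"
proof (cases "L2_set x {..<n} = 0")
  case True
  then have "\<forall>i\<in>{..<n}. x i = 0"
    by (subst (asm) L2_set_eq_0_iff) simp_all
  then show ?thesis
    by (intro that[of basis_vec] L2_set_basis_vec[OF assms]) (simp add: True)
next
  case False
  define r where "r = L2_set x {..<n}"
  have r: "r > 0" using False L2_set_nonneg[of x "{..<n}"] by (simp add: r_def less_le)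
  have "L2_set (\<lambda>i. inverse r * x i) {..<n} = 1"
    using r by (subst L2_set_right_distrib[symmetric]) (auto simp: r_def)
  then show ?thesis
    by (rule that) (use r in \<open>simp flip: r_def\<close>)
qed

lemma bdd_above_abs_peval:
  assumes "variate n f"
  shows "bdd_above ((\<lambda>x. \<bar>peval f x\<bar>) ` {x. L2_set x {..<n} = 1})"
proof (rule bdd_aboveI2)
  fix x :: "nat \<Rightarrow> real" assume "x \<in> {x. L2_set x {..<n} = 1}"
  then have x: "\<bar>x i\<bar> \<le> 1" if "i < n" for i
    using abs_le_L2_set[of "{..<n}" i x] that by simp
  have "\<bar>monom_val \<beta> x\<bar> \<le> 1" if "\<beta> \<in> keys f" for \<beta>
  proof -
    have "\<bar>monom_val \<beta> x\<bar> = (\<Prod>i\<in>keys \<beta>. \<bar>x i\<bar> ^ lookup \<beta> i)"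
      by (simp add: monom_val_def abs_prod power_abs)
    also have "\<dots> \<le> 1"
      using assms that x by (intro prod_le_1) (auto simp: variate_def intro!: power_le_one)
    finally show ?thesis .
  qed
  then have "(\<Sum>\<beta>\<in>keys f. \<bar>lookup f \<beta> * monom_val \<beta> x\<bar>) \<le> (\<Sum>\<beta>\<in>keys f. \<bar>lookup f \<beta>\<bar>)"
    by (intro sum_mono) (simp add: abs_mult mult_left_le)
  then show "\<bar>peval f x\<bar> \<le> (\<Sum>\<beta>\<in>keys f. \<bar>lookup f \<beta>\<bar>)"
    unfolding peval_def monom_eval_eq_monom_val
    using sum_abs[of "\<lambda>\<beta>. lookup f \<beta> * monom_val \<beta> x" "keys f"] by linarith
qed

lemma abs_peval_le_sphere_norm:
  assumes "variate n f" "L2_set x {..<n} = 1"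
  shows "\<bar>peval f x\<bar> \<le> sphere_norm n f"
  unfolding sphere_norm_def
  using assms(2) by (intro cSUP_upper bdd_above_abs_peval[OF assms(1)]) simp

lemma sphere_norm_nonneg:
  assumes "n \<ge> 1" "variate n f"
  shows "0 \<le> sphere_norm n f"
  using abs_peval_le_sphere_norm[OF assms(2) L2_set_basis_vec[OF assms(1)]] by linarith

text \<open>Homogeneity carries the bound from the sphere to all real points, among them the
  unnormalized ones that averaging over phases produces.\<close>

lemma abs_poly_val_le:
  assumes n: "n \<ge> 1" and f: "variate n f" "homogeneous d f"
  shows "\<bar>poly_val f x :: real\<bar> \<le> L2_set x {..<n} ^ d * sphere_norm n f"
proof -
  obtain u where u: "L2_set u {..<n} = 1" "\<And>i. i < n \<Longrightarrow> x i = L2_set x {..<n} * u i"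
    using sphere_parametrization[OF n] by blast
  have "poly_val f x = poly_val f (\<lambda>i. L2_set x {..<n} * u i)"
    using f(1) u(2) by (rule poly_val_cong)
  also have "\<dots> = L2_set x {..<n} ^ d * poly_val f u"
    by (rule poly_val_scale[OF f(2)])
  finally have "\<bar>poly_val f x\<bar> = L2_set x {..<n} ^ d * \<bar>poly_val f u\<bar>"
    by (simp add: abs_mult)
  also have "\<dots> \<le> L2_set x {..<n} ^ d * sphere_norm n f"
    using abs_peval_le_sphere_norm[OF f(1) u(1)]
    by (intro mult_left_mono) (simp_all add: peval_eq_poly_val)
  finally show ?thesis .
qed

section \<open>Averages over roots of unity, and complex arguments\<close>

lemma sum_cis_power_mult_cnj:
  assumes "a < N" "b < N"
  shows "(\<Sum>j<N. cis (2 * pi * real j / real N) ^ a * cnj (cis (2 * pi * real j / real N)) ^ b)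
    = (if a = b then of_nat N else 0)"
proof -
  let ?c = "\<lambda>k. cis (2 * pi * real k / real N)"
  define w where "w = ?c 1"
  \<comment> \<open>The summand for \<open>j\<close> turns out to be \<open>q ^ j\<close>. As
    \<open>q ^ N = 1\<close>, the geometric sum vanishes unless \<open>q = 1\<close>, which for
    exponents below \<open>N\<close> means \<open>a = b\<close>.\<close>
  define q where "q = w ^ a * cnj w ^ b"
  have c: "?c k = w ^ k" for k
    by (simp add: w_def DeMoivre mult.commute)
  have ww: "w * cnj w = 1"
    by (simp add: w_def cis_cnj cis_mult)
  have wN: "w ^ N = 1" using assms by (simp add: w_def DeMoivre)
  then have "q ^ N = 1"
    by (simp add: q_def power_mult_distrib power_mult [symmetric] mult.commute[of _ N])
       (simp add: power_mult flip: complex_cnj_power)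
  have inj: "inj_on ?c {..<N}"
    using assms bij_betw_roots_unity[of N] by (auto simp: bij_betw_def)
  have q1: "q = 1 \<longleftrightarrow> a = b"
  proof
    assume "q = 1"
    then have "w ^ a * (w * cnj w) ^ b = w ^ b"
      by (simp add: q_def power_mult_distrib mult.left_commute)
    then have "?c a = ?c b" by (simp add: ww c)
    then show "a = b" using inj assms by (auto dest: inj_onD)
  next
    assume "a = b"
    then show "q = 1" by (simp add: q_def ww flip: power_mult_distrib)
  qed
  have "(\<Sum>j<N. ?c j ^ a * cnj (?c j) ^ b) = (\<Sum>j<N. q ^ j)"
    unfolding c q_def
    by (intro sum.cong refl) (simp add: power_mult_distrib mult.commute flip: power_mult)
  also have "\<dots> = (if a = b then of_nat N else 0)"
    using \<open>q ^ N = 1\<close> q1 by (simp add: sum_gp_strict)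
  finally show ?thesis .
qed

text \<open>A discrete mean value property: the average retains only the constant coefficient,
  because \<open>N\<close> exceeds all exponents that occur.\<close>

lemma sum_poly_roots_of_unity:
  fixes p :: "complex poly"
  assumes "degree p < N"
  shows "(\<Sum>j<N. poly p (cis (2 * pi * real j / real N))) = of_nat N * poly p 0"
proof -
  let ?c = "\<lambda>k. cis (2 * pi * real k / real N)"
  have "(\<Sum>j<N. poly p (?c j)) = (\<Sum>i\<le>degree p. coeff p i * (\<Sum>j<N. ?c j ^ i))"
    unfolding poly_altdef sum_distrib_left by (rule sum.swap)
  also have "\<dots> = (\<Sum>i\<le>degree p. if i = 0 then of_nat N * coeff p 0 else 0)"
    using assms sum_cis_power_mult_cnj[of _ N 0] by (intro sum.cong refl) auto
  finally show ?thesis by (simp add: poly_0_coeff_0)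
qed

text \<open>The trigonometric polynomial \<open>\<theta> \<mapsto> f (cos \<theta> * Re y + sin \<theta> * Im y)\<close> has \<open>f y / 2 ^ d\<close> as an
  extreme Fourier coefficient, which is at most its maximum.\<close>

lemma cmod_poly_val_le:
  assumes n: "n \<ge> 1" and f: "variate n f" "homogeneous d f"
  shows "cmod (poly_val f y) \<le> (2 * L2_set (\<lambda>i. cmod (y i)) {..<n}) ^ d * sphere_norm n f"
proof -
  define N where "N = Suc d"
  \<comment> \<open>The value of \<open>p\<close> at \<open>\<eta>\<close> is that of
    \<open>f\<close> at \<open>y + \<eta> * cnj y\<close>. The constant coefficient is the value of
    \<open>f\<close> at \<open>y\<close>, and \<open>d + 1\<close> sample points suffice to recover
    it.\<close>
  define p where "p = (\<Sum>\<beta>\<in>keys f. smult (of_real (lookup f \<beta>))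
      (\<Prod>i\<in>keys \<beta>. [:y i, cnj (y i):] ^ lookup \<beta> i))"
  let ?B = "(2 * L2_set (\<lambda>i. cmod (y i)) {..<n}) ^ d * sphere_norm n f"
  have p: "poly p \<eta> = poly_val f (\<lambda>i. y i + \<eta> * cnj (y i))" for \<eta>
    by (simp add: p_def poly_sum poly_prod poly_val_def monom_val_def)
  have "degree p \<le> d"
    unfolding p_def
  proof (rule degree_sum_le)
    fix \<beta> assume "\<beta> \<in> keys f"
    then have "mdeg \<beta> = d" using f by (simp add: homogeneous_def)
    have "degree ([:y i, cnj (y i):] ^ k) \<le> k" for i k
      by (rule order.trans[OF degree_power_le]) simp
    then have "(\<Sum>i\<in>keys \<beta>. degree ([:y i, cnj (y i):] ^ lookup \<beta> i)) \<le> mdeg \<beta>"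
      unfolding mdeg_def by (rule sum_mono)
    then have "degree (\<Prod>i\<in>keys \<beta>. [:y i, cnj (y i):] ^ lookup \<beta> i) \<le> d"
      using degree_prod_sum_le[of "keys \<beta>" "\<lambda>i. [:y i, cnj (y i):] ^ lookup \<beta> i"] \<open>mdeg \<beta> = d\<close>
      by (simp add: o_def)
    then show "degree (smult (of_real (lookup f \<beta>)) (\<Prod>i\<in>keys \<beta>. [:y i, cnj (y i):] ^ lookup \<beta> i)) \<le> d"
      using degree_smult_le order.trans by blast
  qed simp
  have bound: "cmod (poly p (cis (2 * pi * real j / real N))) \<le> ?B" for j
  proof -
    \<comment> \<open>\<open>\<zeta>\<close> has half the angle of the sample point. Extracting it
      leaves the real vector \<open>r\<close> of twice the real parts of
      \<open>cnj \<zeta> * y i\<close>; hence the factor 2 in the bound.\<close>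
    define \<zeta> where "\<zeta> = cis (pi * real j / real N)"
    define r where "r i = 2 * Re (cnj \<zeta> * y i)" for i
    have \<zeta>: "cis (2 * pi * real j / real N) = \<zeta> * \<zeta>" "\<zeta> * cnj \<zeta> = 1" "cmod \<zeta> = 1"
      by (simp_all add: \<zeta>_def cis_mult cis_cnj mult_2[symmetric] add_divide_distrib[symmetric] mult.assoc)
    have "y i + (\<zeta> * \<zeta>) * cnj (y i) = \<zeta> * of_real (r i)" for i
    proof -
      have "of_real (r i) = cnj \<zeta> * y i + cnj (cnj \<zeta> * y i)"
        unfolding r_def complex_add_cnj ..
      then have "\<zeta> * of_real (r i) = (\<zeta> * cnj \<zeta>) * y i + \<zeta> * \<zeta> * cnj (y i)"
        by (simp add: algebra_simps)
      then show ?thesis by (simp add: \<zeta>)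
    qed
    then have "poly p (\<zeta> * \<zeta>) = \<zeta> ^ d * of_real (poly_val f r)"
      unfolding p by (simp add: poly_val_scale[OF f(2)] poly_val_of_real)
    then have "cmod (poly p (\<zeta> * \<zeta>)) = \<bar>poly_val f r\<bar>"
      by (simp add: norm_mult norm_power \<zeta>)
    also have "\<dots> \<le> L2_set r {..<n} ^ d * sphere_norm n f"
      by (rule abs_poly_val_le[OF n f])
    also have "\<dots> \<le> ?B"
    proof (intro mult_right_mono power_mono sphere_norm_nonneg n f L2_set_nonneg)
      have "\<bar>r i\<bar> \<le> 2 * cmod (y i)" for i
        using abs_Re_le_cmod[of "cnj \<zeta> * y i"] by (simp add: r_def norm_mult \<zeta> abs_mult)
      then have "L2_set (\<lambda>i. \<bar>r i\<bar>) {..<n} \<le> L2_set (\<lambda>i. 2 * cmod (y i)) {..<n}"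
        by (intro L2_set_mono) auto
      then show "L2_set r {..<n} \<le> 2 * L2_set (\<lambda>i. cmod (y i)) {..<n}"
        by (simp add: L2_set_right_distrib) (simp add: L2_set_def)
    qed
    finally show ?thesis by (simp add: \<zeta>)
  qed
  have "of_nat N * poly_val f y = (\<Sum>j<N. poly p (cis (2 * pi * real j / real N)))"
    using \<open>degree p \<le> d\<close> by (subst sum_poly_roots_of_unity) (simp_all add: N_def p del: of_nat_Suc)
  then have "real N * cmod (poly_val f y) = cmod (\<Sum>j<N. poly p (cis (2 * pi * real j / real N)))"
    by (metis norm_mult norm_of_nat)
  also have "\<dots> \<le> (\<Sum>j<N. ?B)"
    by (intro sum_norm_le bound)
  finally show ?thesis by (simp add: N_def del: of_nat_Suc)
qed

text \<open>The weights discretize the density \<open>1 + (2 * x / r) * cos \<theta>\<close> (for \<open>a = 0\<close>) or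
  \<open>exp (- 2 * a * \<i> * \<theta>) * (1 + (x / r) * exp (- \<i> * \<theta>))\<close> (for \<open>a > 0\<close>) on the circle of radius \<open>r\<close>.
  For \<open>a = 0\<close> this is a probability measure, so that the mass of the product over all variables
  does not grow with their number.\<close>

lemma extraction_kernel:
  fixes x r :: real
  assumes r: "2 * \<bar>x\<bar> \<le> r" "a > 0 \<Longrightarrow> r > 0" and a: "2 * a \<le> d"
  obtains w :: "nat \<Rightarrow> complex" where
    "(\<Sum>j<d + 2. cmod (w j)) \<le> 2 ^ a"
    "\<And>m. m \<le> d \<Longrightarrow> (\<Sum>j<d + 2. w j * (of_real r * cis (2 * pi * real j / real (d + 2))) ^ m)
      = of_real (r ^ (2 * a) * (if m = 2 * a then 1 else if m = 2 * a + 1 then x else 0))"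
proof -
  \<comment> \<open>The kernels bring in exponents up to \<open>d + 1\<close>, and all exponents
    must lie below \<open>N\<close> for orthogonality.\<close>
  define N where "N = d + 2"
  define c where "c j = cis (2 * pi * real j / real N)" for j
  define s where "s = complex_of_real (x / r)"
  have orth: "(\<Sum>j<N. c j ^ k * cnj (c j) ^ l) = (if k = l then of_nat N else 0)"
    if "k < N" "l < N" for k l
    unfolding c_def by (rule sum_cis_power_mult_cnj[OF that])
  have N: "(of_nat N :: complex) \<noteq> 0" unfolding N_def of_nat_eq_0_iff by simp
  have xr: "\<bar>x / r\<bar> \<le> 1 / 2" using r(1) by (cases "r = 0") (auto simp: abs_divide divide_le_eq)
  \<comment> \<open>If \<open>r = 0\<close>, then \<open>x = 0\<close> as well, and division by zero
    gives the right value.\<close>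
  have rx: "r * (x / r) = x" using r by (cases "r = 0") auto
  show thesis
  proof (cases "a = 0")
    case True
    define w where "w j = (1 + s * (c j + cnj (c j))) / of_nat N" for j
    have mom: "(\<Sum>j<N. w j * (of_real r * c j) ^ m) = of_real (if m = 0 then 1 else if m = 1 then x else 0)"
      if "m \<le> d" for m
    proof -
      have "(\<Sum>j<N. w j * (of_real r * c j) ^ m)
          = of_real r ^ m / of_nat N * ((\<Sum>j<N. c j ^ m * cnj (c j) ^ 0)
            + s * (\<Sum>j<N. c j ^ Suc m * cnj (c j) ^ 0) + s * (\<Sum>j<N. c j ^ m * cnj (c j) ^ 1))"
        unfolding sum_distrib_left sum.distrib[symmetric]
        by (intro sum.cong refl) (simp add: w_def power_mult_distrib algebra_simps add_divide_distrib)
      \<comment> \<open>The middle sum vanishes: its exponent \<open>m + 1\<close> lies between 1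
        and \<open>d + 1\<close>.\<close>
      also have "\<dots> = of_real r ^ m / of_nat N * ((if m = 0 then of_nat N else 0)
            + s * (if m = 1 then of_nat N else 0))"
        using that orth[of m 0] orth[of "Suc m" 0] orth[of m 1] by (simp add: N_def)
      also have "\<dots> = of_real (if m = 0 then 1 else if m = 1 then r * (x / r) else 0)"
        using N by (auto simp: s_def)
      finally show ?thesis unfolding rx .
    qed
    \<comment> \<open>As \<open>x / r\<close> is at most 1/2 in modulus, the weights are
      nonnegative. Their mass is then the moment with \<open>m = 0\<close>, which is 1.\<close>
    have pos: "cmod (w j) = Re (w j)" for j
    proof -
      have w: "w j = of_real ((1 + x / r * (2 * Re (c j))) / real N)"
        by (simp add: w_def s_def complex_add_cnj)
      have "\<bar>x / r * (2 * Re (c j))\<bar> \<le> 1 / 2 * (2 * 1)"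
        unfolding abs_mult using xr abs_Re_le_cmod[of "c j"]
        by (intro mult_mono) (auto simp: c_def)
      then have "0 \<le> 1 + x / r * (2 * Re (c j))"
        unfolding abs_le_iff by linarith
      then have "0 \<le> (1 + x / r * (2 * Re (c j))) / real N"
        by (rule divide_nonneg_nonneg) simp
      then show ?thesis unfolding w by (simp only: norm_of_real Re_complex_of_real abs_of_nonneg)
    qed
    have "(\<Sum>j<N. cmod (w j)) = Re (\<Sum>j<N. w j)" by (simp add: pos)
    also have "\<dots> = 1" using mom[of 0] by simp
    finally show thesis
      using that[of w] mom True by (simp add: N_def c_def)
  next
    case False
    then have "r > 0" using r by simp
    define w where "w j = cnj (c j) ^ (2 * a) * (1 + s * cnj (c j)) / of_nat N" for j
    \<comment> \<open>A crude bound suffices here: a mass of 2 arises only for \<open>a > 0\<close>,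
      where \<open>2 ^ a\<close> absorbs it.\<close>
    have "(\<Sum>j<N. cmod (w j)) \<le> (\<Sum>j<N. 2 / real N)"
    proof (intro sum_mono)
      fix j
      have "cmod (1 + s * cnj (c j)) \<le> 1 + 1 / 2"
        using xr by (intro order.trans[OF norm_triangle_ineq] add_mono)
          (simp_all add: norm_mult s_def c_def norm_divide abs_divide)
      then show "cmod (w j) \<le> 2 / real N"
        by (simp add: w_def norm_mult norm_divide norm_power c_def divide_right_mono)
    qed
    also have "\<dots> = 2" using N by simp
    also have "2 \<le> (2::real) ^ a" using False power_increasing[of 1 a "2::real"] by simp
    finally have "(\<Sum>j<N. cmod (w j)) \<le> 2 ^ a" .
    moreover have "(\<Sum>j<N. w j * (of_real r * c j) ^ m)
        = of_real (r ^ (2 * a) * (if m = 2 * a then 1 else if m = 2 * a + 1 then x else 0))"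
      if "m \<le> d" for m
    proof -
      have "(\<Sum>j<N. w j * (of_real r * c j) ^ m)
          = of_real r ^ m / of_nat N * ((\<Sum>j<N. c j ^ m * cnj (c j) ^ (2 * a))
            + s * (\<Sum>j<N. c j ^ m * cnj (c j) ^ (2 * a + 1)))"
        unfolding sum_distrib_left sum.distrib[symmetric]
        by (intro sum.cong refl) (simp add: w_def power_mult_distrib algebra_simps add_divide_distrib)
      also have "\<dots> = of_real r ^ m / of_nat N * ((if m = 2 * a then of_nat N else 0)
            + s * (if m = 2 * a + 1 then of_nat N else 0))"
        using that a orth[of m "2 * a"] orth[of m "2 * a + 1"] by (simp add: N_def)
      finally show ?thesis
        using N \<open>r > 0\<close> by (auto simp: s_def)
    qed
    ultimately show thesis
      using that[of w] by (simp add: N_def c_def)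
  qed
qed

text \<open>The product of the kernels of all variables acts on a monomial coordinatewise: in
  coordinate \<open>i\<close> only the exponents \<open>2 * lookup \<alpha> i\<close> and one more
  survive, the odd factor becoming \<open>x i\<close>. The average of \<open>f\<close> is therefore
  \<open>r ^ 2\<alpha>\<close> times the value of \<open>F \<alpha>\<close> at \<open>x\<close>, and
  the triangle inequality with the bound at complex points concludes.\<close>

lemma abs_multilinear_part_le:
  fixes x r :: "nat \<Rightarrow> real"
  assumes n: "n \<ge> 1" and f: "variate n f" "homogeneous d f"
    and dec: "multilinear_decomposition n d f F" and \<alpha>: "\<alpha> \<in> multi_indices n (d div 2)"
    and r: "\<And>i. i < n \<Longrightarrow> 2 * \<bar>x i\<bar> \<le> r i" "\<And>i. i \<in> keys \<alpha> \<Longrightarrow> r i > 0"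
  shows "(\<Prod>i<n. r i ^ (2 * lookup \<alpha> i)) * \<bar>poly_val (F \<alpha>) x\<bar>
    \<le> 2 ^ mdeg \<alpha> * (2 * L2_set r {..<n}) ^ d * sphere_norm n f"
proof -
  let ?I = "multi_indices n (d div 2)"
  define c where "c j = cis (2 * pi * real j / real (d + 2))" for j
  define R where "R = (\<Prod>i<n. r i ^ (2 * lookup \<alpha> i))"
  have keys\<alpha>: "keys \<alpha> \<subseteq> {..<n}" "2 * mdeg \<alpha> \<le> d" using \<alpha> by (auto simp: multi_indices_def)
  have r0: "0 \<le> r i" if "i < n" for i using r(1)[OF that] by linarith
  define kernel where "kernel i v \<longleftrightarrow> (\<Sum>j<d + 2. cmod (v j)) \<le> 2 ^ lookup \<alpha> i \<and>
      (\<forall>m\<le>d. (\<Sum>j<d + 2. v j * (of_real (r i) * c j) ^ m) = of_real (r i ^ (2 * lookup \<alpha> i)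
        * (if m = 2 * lookup \<alpha> i then 1 else if m = 2 * lookup \<alpha> i + 1 then x i else 0)))"
    for i and v :: "nat \<Rightarrow> complex"
  have "\<exists>v. kernel i v" if i: "i < n" for i
  proof (rule extraction_kernel[OF r(1)[OF i], of "lookup \<alpha> i" d])
    show "lookup \<alpha> i > 0 \<Longrightarrow> r i > 0" using r(2) by (simp add: in_keys_iff)
    show "2 * lookup \<alpha> i \<le> d" using lookup_le_mdeg[of \<alpha> i] keys\<alpha> by linarith
  next
    fix v :: "nat \<Rightarrow> complex"
    assume "(\<Sum>j<d + 2. cmod (v j)) \<le> 2 ^ lookup \<alpha> i"
      "\<And>m. m \<le> d \<Longrightarrow> (\<Sum>j<d + 2. v j * (of_real (r i) * cis (2 * pi * real j / real (d + 2))) ^ m)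
        = of_real (r i ^ (2 * lookup \<alpha> i)
          * (if m = 2 * lookup \<alpha> i then 1 else if m = 2 * lookup \<alpha> i + 1 then x i else 0))"
    then have "kernel i v" unfolding kernel_def c_def by blast
    then show "\<exists>v. kernel i v" by blast
  qed
  then obtain w where w: "\<And>i. i < n \<Longrightarrow> kernel i (w i)" by metis
  have w_mass: "(\<Sum>j<d + 2. cmod (w i j)) \<le> 2 ^ lookup \<alpha> i" if "i < n" for i
    using w[OF that] unfolding kernel_def by blast
  have w_mom: "(\<Sum>j<d + 2. w i j * (of_real (r i) * c j) ^ m) = of_real (r i ^ (2 * lookup \<alpha> i)
      * (if m = 2 * lookup \<alpha> i then 1 else if m = 2 * lookup \<alpha> i + 1 then x i else 0))"
    if "i < n" "m \<le> d" for i m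
    using w[OF that(1)] that(2) unfolding kernel_def by blast
  \<comment> \<open>A point of \<open>J\<close> chooses one root of unity per variable; sums over
    \<open>J\<close> of products factor into sums per variable.\<close>
  define J where "J = PiE {..<n} (\<lambda>_. {..<d + 2})"
  define W where "W j = (\<Prod>i<n. w i (j i))" for j
  define y where "y j i = of_real (r i) * c (j i)" for j :: "nat \<Rightarrow> nat" and i
  have mon: "(\<Sum>j\<in>J. W j * monom_val (\<gamma> + (\<alpha>' + \<alpha>')) (y j))
      = (if \<alpha>' = \<alpha> then of_real (R * monom_val \<gamma> x) else 0)"
    if \<alpha>': "\<alpha>' \<in> ?I" and \<gamma>: "\<gamma> \<in> keys (F \<alpha>')" for \<alpha>' \<gamma>
  proof -
    let ?\<beta> = "\<gamma> + (\<alpha>' + \<alpha>')"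
    have F: "variate n (F \<alpha>')" "homogeneous (d - 2 * mdeg \<alpha>') (F \<alpha>')" "multilinear (F \<alpha>')"
      using dec \<alpha>' by (auto simp: multilinear_decomposition_def)
    have k: "keys \<gamma> \<subseteq> {..<n}" "keys \<alpha>' \<subseteq> {..<n}" using F(1) \<gamma> \<alpha>'
      by (auto simp: variate_def multi_indices_def)
    then have k\<beta>: "keys ?\<beta> \<subseteq> {..<n}"
      using Poly_Mapping.keys_add[of \<gamma> "\<alpha>' + \<alpha>'"] Poly_Mapping.keys_add[of \<alpha>' \<alpha>'] by blast
    have "mdeg ?\<beta> = d" using F(2) \<gamma> \<alpha>' by (auto simp: homogeneous_def mdeg_add multi_indices_def)
    then have le: "lookup ?\<beta> i \<le> d" for i using lookup_le_mdeg[of ?\<beta> i] by simp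
    have \<gamma>1: "lookup \<gamma> i \<le> 1" for i using F(3) \<gamma> by (auto simp: multilinear_def)
    have "(\<Sum>j\<in>J. W j * monom_val ?\<beta> (y j))
        = (\<Sum>j\<in>J. \<Prod>i<n. w i (j i) * (of_real (r i) * c (j i)) ^ lookup ?\<beta> i)"
      by (simp add: W_def y_def monom_val_superset[OF _ k\<beta>] flip: prod.distrib)
    also have "\<dots> = (\<Prod>i<n. \<Sum>j<d + 2. w i j * (of_real (r i) * c j) ^ lookup ?\<beta> i)"
      unfolding J_def by (rule prod_sum_PiE[symmetric]) auto
    also have "\<dots> = (\<Prod>i<n. of_real (r i ^ (2 * lookup \<alpha> i) * (if lookup ?\<beta> i = 2 * lookup \<alpha> i then 1
        else if lookup ?\<beta> i = 2 * lookup \<alpha> i + 1 then x i else 0)))"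
      by (intro prod.cong refl w_mom le) simp
    also have "\<dots> = of_real (R * (\<Prod>i<n. if lookup ?\<beta> i = 2 * lookup \<alpha> i then 1
        else if lookup ?\<beta> i = 2 * lookup \<alpha> i + 1 then x i else 0))"
      by (simp add: R_def prod.distrib)
    also have "\<dots> = (if \<alpha>' = \<alpha> then of_real (R * monom_val \<gamma> x) else 0)"
    proof (cases "\<alpha>' = \<alpha>")
      case True
      have "(if lookup ?\<beta> i = 2 * lookup \<alpha> i then 1
          else if lookup ?\<beta> i = 2 * lookup \<alpha> i + 1 then x i else 0) = x i ^ lookup \<gamma> i" for i
        using \<gamma>1[of i] True by (auto simp: lookup_add le_Suc_eq)
      then show ?thesis using True by (simp add: monom_val_superset[OF _ k(1)])
    next
      case False
      then obtain i where i: "lookup \<alpha>' i \<noteq> lookup \<alpha> i" by (meson poly_mapping_eqI)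
      then have "i \<in> keys \<alpha>' \<union> keys \<alpha>" by (auto simp: in_keys_iff)
      then have "i < n" using k keys\<alpha> by auto
      moreover have "lookup ?\<beta> i \<noteq> 2 * lookup \<alpha> i \<and> lookup ?\<beta> i \<noteq> 2 * lookup \<alpha> i + 1"
        using i \<gamma>1[of i] unfolding lookup_add by presburger
      ultimately have "(\<Prod>i<n. if lookup ?\<beta> i = 2 * lookup \<alpha> i then 1
          else if lookup ?\<beta> i = 2 * lookup \<alpha> i + 1 then x i else 0) = 0"
        by (intro prod_zero) auto
      then show ?thesis using False by (simp only: mult_zero_right of_real_0 if_False)
    qed
    finally show ?thesis .
  qed
  have "(\<Sum>j\<in>J. W j * poly_val f (y j))
      = (\<Sum>j\<in>J. \<Sum>\<alpha>'\<in>?I. \<Sum>\<gamma>\<in>keys (F \<alpha>'). of_real (lookup (F \<alpha>') \<gamma>)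
          * (W j * monom_val (\<gamma> + (\<alpha>' + \<alpha>')) (y j)))"
    unfolding poly_val_multilinear_decomposition[OF dec]
    by (simp add: poly_val_def) (simp add: sum_distrib_left sum_distrib_right monom_val_add mult_ac)
  also have "\<dots> = (\<Sum>\<alpha>'\<in>?I. \<Sum>j\<in>J. \<Sum>\<gamma>\<in>keys (F \<alpha>'). of_real (lookup (F \<alpha>') \<gamma>)
          * (W j * monom_val (\<gamma> + (\<alpha>' + \<alpha>')) (y j)))"
    by (rule sum.swap)
  also have "\<dots> = (\<Sum>\<alpha>'\<in>?I. \<Sum>\<gamma>\<in>keys (F \<alpha>'). of_real (lookup (F \<alpha>') \<gamma>)
          * (\<Sum>j\<in>J. W j * monom_val (\<gamma> + (\<alpha>' + \<alpha>')) (y j)))"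
    unfolding sum_distrib_left by (intro sum.cong refl sum.swap)
  also have "\<dots> = (\<Sum>\<alpha>'\<in>?I. if \<alpha>' = \<alpha> then of_real (R * poly_val (F \<alpha>) x) else 0)"
    using mon by (intro sum.cong refl) (auto simp: poly_val_def sum_distrib_left mult_ac)
  also have "\<dots> = of_real (R * poly_val (F \<alpha>) x)"
    using \<alpha> by (simp add: finite_multi_indices)
  finally have eq: "(\<Sum>j\<in>J. W j * poly_val f (y j)) = of_real (R * poly_val (F \<alpha>) x)" .
  have "R \<ge> 0" using r0 unfolding R_def by (intro prod_nonneg) simp
  then have "R * \<bar>poly_val (F \<alpha>) x\<bar> = cmod (\<Sum>j\<in>J. W j * poly_val f (y j))"
    unfolding eq by (simp add: abs_mult norm_mult)
  also have "\<dots> \<le> (\<Sum>j\<in>J. cmod (W j) * ((2 * L2_set r {..<n}) ^ d * sphere_norm n f))"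
  proof (intro sum_norm_le)
    fix j
    have "L2_set (\<lambda>i. cmod (y j i)) {..<n} = L2_set r {..<n}"
      using r0 by (intro L2_set_cong) (auto simp: y_def c_def norm_mult)
    then show "cmod (W j * poly_val f (y j))
        \<le> cmod (W j) * ((2 * L2_set r {..<n}) ^ d * sphere_norm n f)"
      using cmod_poly_val_le[OF n f, of "y j"] by (simp add: norm_mult mult_left_mono)
  qed
  also have "\<dots> = (\<Sum>j\<in>J. cmod (W j)) * ((2 * L2_set r {..<n}) ^ d * sphere_norm n f)"
    by (simp add: sum_distrib_right)
  also have "\<dots> \<le> 2 ^ mdeg \<alpha> * ((2 * L2_set r {..<n}) ^ d * sphere_norm n f)"
  proof (intro mult_right_mono)
    \<comment> \<open>The mass of the product is the product of the masses. Variables outside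
      \<open>keys \<alpha>\<close> contribute at most 1 each, so their number does not
      enter.\<close>
    have "(\<Sum>j\<in>J. cmod (W j)) = (\<Prod>i<n. \<Sum>j<d + 2. cmod (w i j))"
      unfolding J_def W_def by (subst prod_sum_PiE) (auto simp: prod_norm)
    also have "\<dots> \<le> (\<Prod>i<n. 2 ^ lookup \<alpha> i)"
      using w_mass by (intro prod_mono conjI sum_nonneg) auto
    also have "\<dots> = 2 ^ mdeg \<alpha>"
      by (simp add: mdeg_superset[OF _ keys\<alpha>(1)] power_sum)
    finally show "(\<Sum>j\<in>J. cmod (W j)) \<le> 2 ^ mdeg \<alpha>" .
  qed (use sphere_norm_nonneg[OF n f(1)] in simp)
  finally show ?thesis by (simp add: R_def mult.assoc)
qed

section \<open>The size of multinomial coefficients and the norm bound\<close>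

lemma self_power_le_fact: "real k ^ k \<le> 3 ^ k * fact k"
proof -
  \<comment> \<open>The left side is one term of the exponential series at \<open>k\<close>, whose
    terms are nonnegative.\<close>
  have "real k ^ k /\<^sub>R fact k \<le> suminf (\<lambda>j. real k ^ j /\<^sub>R fact j)"
    using sum_le_suminf[OF summable_exp_generic[of "real k"], of "{k}"] by simp
  also have "\<dots> = exp (real k)"
    by (simp add: exp_def)
  also have "\<dots> = exp 1 ^ k"
    using exp_of_nat_mult[of k "1::real"] by simp
  also have "\<dots> \<le> 3 ^ k"
    by (intro power_mono exp_le) simp
  finally show ?thesis by (simp add: field_simps)
qed

text \<open>In the multinomial formula the factorial of each exponent is at most its self-power, and
  the factorial of \<open>mdeg \<alpha>\<close> is bounded below by
  \<open>self_power_le_fact\<close>.\<close>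

lemma card_arrangements_ge:
  assumes "keys \<alpha> \<subseteq> {..<n}"
  shows "1 \<le> 3 ^ mdeg \<alpha> * real (card (arrangements \<alpha>))
    * (\<Prod>i<n. (real (lookup \<alpha> i) / real (mdeg \<alpha>)) ^ lookup \<alpha> i)"
proof (cases "mdeg \<alpha> = 0")
  case True
  \<comment> \<open>All factors of the product are then \<open>0 / 0\<close> to the power 0, hence
    1.\<close>
  then have "lookup \<alpha> i = 0" for i using lookup_le_mdeg[of \<alpha> i] by simp
  then show ?thesis using card_arrangements_pos[of \<alpha>] True by (simp add: Suc_le_eq)
next
  case False
  define k where "k = mdeg \<alpha>"
  define P where "P = (\<Prod>i\<in>keys \<alpha>. real (lookup \<alpha> i) ^ lookup \<alpha> i)"
  have "(\<Prod>i\<in>keys \<alpha>. fact (lookup \<alpha> i)) \<le> P"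
    unfolding P_def using fact_le_power[where ?'a = real] by (intro prod_mono) auto
  then have "real (card (arrangements \<alpha>)) * (\<Prod>i\<in>keys \<alpha>. fact (lookup \<alpha> i))
      \<le> real (card (arrangements \<alpha>)) * P"
    by (intro mult_left_mono) auto
  moreover have "real (card (arrangements \<alpha>)) * (\<Prod>i\<in>keys \<alpha>. fact (lookup \<alpha> i)) = fact k"
    using arg_cong[OF card_arrangements[of \<alpha>], of real] by (simp add: k_def)
  ultimately have "3 ^ k * fact k \<le> 3 ^ k * (real (card (arrangements \<alpha>)) * P)"
    by (intro mult_left_mono) auto
  from order.trans[OF self_power_le_fact this]
  have "real k ^ k \<le> 3 ^ k * real (card (arrangements \<alpha>)) * P"
    by (simp only: mult.assoc)
  moreover have prod: "(\<Prod>i<n. (real (lookup \<alpha> i) / real k) ^ lookup \<alpha> i) = P / real k ^ k"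
  proof -
    have "(\<Prod>i<n. (real (lookup \<alpha> i) / real k) ^ lookup \<alpha> i)
        = (\<Prod>i\<in>keys \<alpha>. (real (lookup \<alpha> i) / real k) ^ lookup \<alpha> i)"
      using assms by (intro prod.mono_neutral_right) (auto simp: in_keys_iff)
    then show ?thesis
      by (simp add: P_def k_def mdeg_def power_divide prod_dividef power_sum)
  qed
  moreover have "real k ^ k > 0" using False by (simp add: k_def)
  ultimately show ?thesis
    unfolding k_def[symmetric] prod by (simp add: pos_le_divide_eq)
qed

text \<open>The radii must dominate \<open>2 * \<bar>x i\<bar>\<close> for the kernels, have norm at
  most 3, and keep \<open>r ^ 2\<alpha>\<close> comparable to the inverse multinomial coefficient.
  The norm costs \<open>6 ^ d\<close>; the kernel mass and the multinomial estimate cost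
  \<open>6 ^ k\<close>, which is at most \<open>6 ^ d\<close>.\<close>

lemma sphere_norm_multilinear_part_le:
  assumes n: "n \<ge> 1" and f: "variate n f" "homogeneous d f"
    and dec: "multilinear_decomposition n d f F" and \<alpha>: "\<alpha> \<in> multi_indices n (d div 2)"
  shows "sphere_norm n (F \<alpha>) \<le> 36 ^ d * sphere_norm n f * card (arrangements \<alpha>)"
  unfolding sphere_norm_def[of n "F \<alpha>"]
proof (rule cSUP_least)
  show "{x. L2_set x {..<n} = 1} \<noteq> {}" using L2_set_basis_vec[OF n] by blast
next
  fix x :: "nat \<Rightarrow> real" assume "x \<in> {x. L2_set x {..<n} = 1}"
  then have x: "L2_set x {..<n} = 1" by simp
  define k where "k = mdeg \<alpha>"
  \<comment> \<open>This vector maximizes \<open>s ^ 2\<alpha>\<close> over the unit ball. For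
    \<open>k = 0\<close> it is zero by the convention for division, so its norm is only claimed to
    be at most 1.\<close>
  define s where "s i = sqrt (real (lookup \<alpha> i) / real k)" for i
  define r where "r i = 2 * \<bar>x i\<bar> + s i" for i
  define A where "A = real (card (arrangements \<alpha>))"
  have keys\<alpha>: "keys \<alpha> \<subseteq> {..<n}" "2 * k \<le> d" using \<alpha> by (auto simp: multi_indices_def k_def)
  have s0: "0 \<le> s i" for i by (simp add: s_def)
  have "L2_set s {..<n} \<le> 1"
  proof -
    have "(\<Sum>i<n. (s i)\<^sup>2) = (\<Sum>i<n. real (lookup \<alpha> i)) / real k"
      by (simp add: s_def flip: sum_divide_distrib)
    moreover have "(\<Sum>i<n. real (lookup \<alpha> i)) = real k"
      using mdeg_superset[OF _ keys\<alpha>(1)] by (simp add: k_def)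
    ultimately have "(\<Sum>i<n. (s i)\<^sup>2) = real k / real k" by simp
    then show ?thesis by (simp add: L2_set_def divide_le_eq_1)
  qed
  moreover have "L2_set (\<lambda>i. 2 * \<bar>x i\<bar>) {..<n} = 2"
    using x by (simp add: L2_set_right_distrib[symmetric]) (simp add: L2_set_def)
  ultimately have "L2_set r {..<n} \<le> 3"
    using L2_set_triangle_ineq[of "\<lambda>i. 2 * \<bar>x i\<bar>" s "{..<n}"] unfolding r_def by linarith
  then have r6: "(2 * L2_set r {..<n}) ^ d \<le> 6 ^ d"
    by (intro power_mono) auto
  have pos: "r i > 0" if "i \<in> keys \<alpha>" for i
  proof -
    have "lookup \<alpha> i > 0" using that by (simp add: in_keys_iff)
    then have "s i > 0" using lookup_le_mdeg[of \<alpha> i] by (simp add: s_def k_def)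
    then show ?thesis by (simp add: r_def add_nonneg_pos)
  qed
  have "(\<Prod>i<n. (real (lookup \<alpha> i) / real k) ^ lookup \<alpha> i) \<le> (\<Prod>i<n. r i ^ (2 * lookup \<alpha> i))"
  proof (intro prod_mono conjI)
    fix i
    have "(s i)\<^sup>2 \<le> (r i)\<^sup>2" using s0[of i] by (intro power_mono) (auto simp: r_def)
    then show "(real (lookup \<alpha> i) / real k) ^ lookup \<alpha> i \<le> r i ^ (2 * lookup \<alpha> i)"
      unfolding power_mult by (intro power_mono) (auto simp: s_def)
  qed simp
  then have "3 ^ k * A * (\<Prod>i<n. (real (lookup \<alpha> i) / real k) ^ lookup \<alpha> i)
      \<le> 3 ^ k * A * (\<Prod>i<n. r i ^ (2 * lookup \<alpha> i))"
    by (rule mult_left_mono) (simp add: A_def)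
  then have "1 \<le> 3 ^ k * A * (\<Prod>i<n. r i ^ (2 * lookup \<alpha> i))"
    using card_arrangements_ge[OF keys\<alpha>(1)] unfolding k_def[symmetric] A_def[symmetric] by linarith
  then have "\<bar>poly_val (F \<alpha>) x\<bar> \<le> 3 ^ k * A * (\<Prod>i<n. r i ^ (2 * lookup \<alpha> i)) * \<bar>poly_val (F \<alpha>) x\<bar>"
    by (metis abs_ge_zero mult_1 mult_right_mono)
  also have "\<dots> = 3 ^ k * A * ((\<Prod>i<n. r i ^ (2 * lookup \<alpha> i)) * \<bar>poly_val (F \<alpha>) x\<bar>)"
    by simp
  also have "\<dots> \<le> 3 ^ k * A * (2 ^ k * (2 * L2_set r {..<n}) ^ d * sphere_norm n f)"
    unfolding k_def using s0
    by (intro mult_left_mono abs_multilinear_part_le[OF n f dec \<alpha> _ pos]) (auto simp: r_def A_def)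
  also have "\<dots> \<le> 3 ^ k * A * (2 ^ k * 6 ^ d * sphere_norm n f)"
    using r6 sphere_norm_nonneg[OF n f(1)] by (intro mult_left_mono mult_right_mono) (auto simp: A_def)
  also have "\<dots> = 6 ^ k * (6 ^ d * sphere_norm n f * A)"
    by (simp flip: power_mult_distrib)
  also have "\<dots> \<le> 6 ^ d * (6 ^ d * sphere_norm n f * A)"
    using keys\<alpha>(2) sphere_norm_nonneg[OF n f(1)]
    by (intro mult_right_mono power_increasing) (auto simp: A_def)
  also have "\<dots> = 36 ^ d * sphere_norm n f * A"
    by (simp flip: power_mult_distrib)
  finally show "\<bar>peval (F \<alpha>) x\<bar> \<le> 36 ^ d * sphere_norm n f * card (arrangements \<alpha>)"
    by (simp add: peval_eq_poly_val A_def)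
qed

section \<open>Vanishing norms, the sign of the maximum, and assembly of the bounds\<close>

lemma Lambda_le_0_if_sphere_norm_eq_0:
  assumes n: "n \<ge> 1" and h: "variate n h" "homogeneous t h" and "sphere_norm n h = 0"
  shows "Lambda n t h \<le> 0"
proof (rule Lambda_le[OF n])
  \<comment> \<open>A polynomial of norm 0 vanishes as a function, so the zero matrix represents it.
    This covers parts whose ratio is 0 by convention and says nothing about
    \<open>Lambda\<close>.\<close>
  have "peval h x = 0" for x
    using abs_poly_val_le[OF n h, of x] assms(4) by (simp add: peval_eq_poly_val)
  then show "matrix_rep n t h (\<lambda>_ _. 0)"
    by (simp add: matrix_rep_def quad_form_def)
qed (simp add: quad_form_def)

text \<open>A multilinear monomial of degree at least 2 contains a variable other than
  \<open>x 0\<close>, and this variable is 0 at \<open>basis_vec\<close>. With the lower bound for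
  \<open>Lambda\<close> this makes \<open>Lambda\<close> nonnegative on such polynomials of even
  degree.\<close>

lemma poly_val_basis_vec_multilinear:
  assumes "homogeneous t h" "multilinear h" "t \<ge> 2"
  shows "poly_val h basis_vec = 0"
  unfolding poly_val_def
proof (intro sum.neutral ballI)
  fix \<beta> assume \<beta>: "\<beta> \<in> keys h"
  have "\<exists>i\<in>keys \<beta>. i \<noteq> 0"
  proof (rule ccontr)
    assume "\<not> ?thesis"
    then have "mdeg \<beta> = (\<Sum>i\<in>{0}. lookup \<beta> i)" by (intro mdeg_superset) auto
    moreover have "lookup \<beta> 0 \<le> 1" using assms(2) \<beta> by (simp add: multilinear_def)
    ultimately show False using assms(1,3) \<beta> by (simp add: homogeneous_def)
  qed
  then have "monom_val \<beta> basis_vec = 0"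
    unfolding monom_val_def by (intro prod_zero) (auto simp: basis_vec_def in_keys_iff)
  then show "of_real (lookup h \<beta>) * monom_val \<beta> basis_vec = 0" by simp
qed

text \<open>Combining the representations of the parts loses \<open>d div 2 + 1\<close> and their
  norm bounds lose \<open>36 ^ d\<close>, while the multinomial coefficients cancel.\<close>

lemma Lambda_multilinear_ratio_le:
  assumes n: "n \<ge> 1" and d: "even d" "d \<ge> 2" and f: "variate n f" "homogeneous d f"
    and dec: "multilinear_decomposition n d f F"
    and R: "\<And>\<alpha>. \<alpha> \<in> multi_indices n (d div 2) \<Longrightarrow>
      Lambda n (d - 2 * mdeg \<alpha>) (F \<alpha>) / sphere_norm n (F \<alpha>) \<le> R"
  shows "Lambda n d f / sphere_norm n f \<le> 2 powr (7 * real d) * R"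
proof -
  let ?I = "multi_indices n (d div 2)"
  let ?\<nu> = "sphere_norm n f"
  have F: "variate n (F \<alpha>)" "homogeneous (d - 2 * mdeg \<alpha>) (F \<alpha>)" "multilinear (F \<alpha>)"
    if "\<alpha> \<in> ?I" for \<alpha>
    using dec that by (auto simp: multilinear_decomposition_def)
  have \<nu>: "0 \<le> ?\<nu>" by (rule sphere_norm_nonneg[OF n f(1)])
  have rep: "\<exists>M. matrix_rep n (d - 2 * mdeg \<alpha>) (F \<alpha>) M" if "\<alpha> \<in> ?I" for \<alpha>
    using F[OF that] d(1) by (intro matrix_rep_exists) auto
  \<comment> \<open>The estimates below multiply \<open>R\<close> by upper bounds for norms, so its
    sign matters. It comes from the index 0, whose part has degree \<open>d \<ge> 2\<close>.\<close>
  have "R \<ge> 0"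
  proof -
    have F0: "variate n (F 0)" "homogeneous d (F 0)" "multilinear (F 0)" using F[of 0] by simp_all
    obtain M where "matrix_rep n d (F 0) M" using rep[of 0] by auto
    then have "0 \<le> Lambda n d (F 0)"
      using peval_basis_vec_le_Lambda[OF n] poly_val_basis_vec_multilinear[OF F0(2,3) d(2)]
      by (fastforce simp: peval_eq_poly_val)
    then have "0 \<le> Lambda n d (F 0) / sphere_norm n (F 0)"
      by (rule divide_nonneg_nonneg) (rule sphere_norm_nonneg[OF n F0(1)])
    also have "\<dots> \<le> R" using R[of 0] by simp
    finally show ?thesis .
  qed
  define B where "B = R * (36 ^ d * ?\<nu>)"
  have LB: "Lambda n (d - 2 * mdeg \<alpha>) (F \<alpha>) \<le> B * card (arrangements \<alpha>)" if \<alpha>: "\<alpha> \<in> ?I" for \<alpha>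
  proof -
    have "Lambda n (d - 2 * mdeg \<alpha>) (F \<alpha>) \<le> R * sphere_norm n (F \<alpha>)"
    proof (cases "sphere_norm n (F \<alpha>) = 0")
      case True
      then show ?thesis using Lambda_le_0_if_sphere_norm_eq_0[OF n F(1,2)[OF \<alpha>]] by simp
    next
      case False
      then have "sphere_norm n (F \<alpha>) > 0"
        using sphere_norm_nonneg[OF n F(1)[OF \<alpha>]] by linarith
      then show ?thesis using R[OF \<alpha>] by (simp add: pos_divide_le_eq)
    qed
    also have "\<dots> \<le> R * (36 ^ d * ?\<nu> * card (arrangements \<alpha>))"
      by (intro mult_left_mono sphere_norm_multilinear_part_le n f dec \<alpha> \<open>R \<ge> 0\<close>)
    finally show ?thesis by (simp add: B_def mult.assoc)
  qed
  have "Lambda n d f \<le> real (d div 2 + 1) * B"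
  proof (rule field_le_epsilon)
    fix e :: real assume "e > 0"
    \<comment> \<open>The slack \<open>e\<close> is shared by the \<open>d div 2 + 1\<close> values
      of \<open>k\<close> and pays for representations that are only nearly optimal.\<close>
    define e' where "e' = e / real (d div 2 + 1)"
    have e': "e' > 0" using \<open>e > 0\<close> by (simp add: e'_def)
    have "\<exists>M. matrix_rep n (d - 2 * mdeg \<alpha>) (F \<alpha>) M \<and>
        (\<forall>z. L2_set z (tuples n (d div 2 - mdeg \<alpha>)) = 1 \<longrightarrow>
          quad_form n (d div 2 - mdeg \<alpha>) M z \<le> (B + e') * card (arrangements \<alpha>))"
      if \<alpha>: "\<alpha> \<in> ?I" for \<alpha>
    proof -
      have "0 < e' * card (arrangements \<alpha>)"
        using e' card_arrangements_pos[of \<alpha>] by simp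
      then have "Lambda n (d - 2 * mdeg \<alpha>) (F \<alpha>) < (B + e') * card (arrangements \<alpha>)"
        using LB[OF \<alpha>] unfolding distrib_right by linarith
      moreover obtain M0 where "matrix_rep n (d - 2 * mdeg \<alpha>) (F \<alpha>) M0" using rep[OF \<alpha>] by blast
      moreover have "(d - 2 * mdeg \<alpha>) div 2 = d div 2 - mdeg \<alpha>" by simp
      ultimately show ?thesis by (metis Lambda_less_obtains)
    qed
    then obtain M where M: "\<And>\<alpha>. \<alpha> \<in> ?I \<Longrightarrow> matrix_rep n (d - 2 * mdeg \<alpha>) (F \<alpha>) (M \<alpha>) \<and>
        (\<forall>z. L2_set z (tuples n (d div 2 - mdeg \<alpha>)) = 1 \<longrightarrow>
          quad_form n (d div 2 - mdeg \<alpha>) (M \<alpha>) z \<le> (B + e') * card (arrangements \<alpha>))"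
      by metis
    have "Lambda n d f \<le> real (d div 2 + 1) * (B + e')"
      using M by (intro Lambda_le_multilinear_decomposition[OF n dec, of M]) blast+
    also have "\<dots> = real (d div 2 + 1) * B + e"
      by (simp add: e'_def distrib_left del: of_nat_add of_nat_Suc)
    finally show "Lambda n d f \<le> real (d div 2 + 1) * B + e" .
  qed
  also have "\<dots> \<le> 2 ^ d * B"
  proof (rule mult_right_mono)
    have "d div 2 + 1 \<le> 2 ^ d"
      using less_exp[of d] by linarith
    then show "real (d div 2 + 1) \<le> 2 ^ d"
      by (metis of_nat_le_iff of_nat_numeral of_nat_power)
  qed (use \<open>R \<ge> 0\<close> \<nu> in \<open>simp add: B_def\<close>)
  also have "\<dots> = 72 ^ d * R * ?\<nu>"
    by (simp add: B_def flip: power_mult_distrib)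
  also have "\<dots> \<le> 2 powr (7 * real d) * R * ?\<nu>"
  proof (intro mult_right_mono)
    \<comment> \<open>The losses \<open>2 ^ d\<close> and \<open>36 ^ d\<close> multiply to
      \<open>72 ^ d\<close>, and 72 is below \<open>2 ^ 7\<close>.\<close>
    have "2 powr (7 * real d) = (2 ^ 7) ^ d"
      by (simp add: powr_powr[symmetric] powr_realpow)
    moreover have "(72::real) ^ d \<le> (2 ^ 7) ^ d" by (intro power_mono) auto
    ultimately show "72 ^ d \<le> 2 powr (7 * real d)" by simp
  qed (use \<open>R \<ge> 0\<close> \<nu> in auto)
  finally have le: "Lambda n d f \<le> 2 powr (7 * real d) * R * ?\<nu>" .
  show ?thesis
  proof (cases "?\<nu> = 0")
    case True
    then show ?thesis using \<open>R \<ge> 0\<close> by simp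
  next
    case False
    then show ?thesis using le \<nu> by (simp add: pos_divide_le_eq)
  qed
qed

lemma multi_indices_0: "multi_indices n 0 = {0}"
proof -
  have "\<alpha> = 0" if "mdeg \<alpha> = 0" for \<alpha>
    using lookup_le_mdeg[of \<alpha>] that by (intro poly_mapping_eqI) simp
  then show ?thesis by (auto simp: multi_indices_def)
qed

theorem theorem5p13:
  "\<exists>C::real. C \<ge> 0 \<and>
     (\<forall>(n::nat) (d::nat) (f::rpoly).
        n \<ge> 1 \<longrightarrow> even d \<longrightarrow> variate n f \<longrightarrow> homogeneous d f \<longrightarrow>
          (\<exists>!F. multilinear_decomposition n d f F) \<and>
          (\<forall>F. multilinear_decomposition n d f F \<longrightarrow>
             Lambda n d f / sphere_norm n f
               \<le> 2 powr (C * real d) *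
                 (MAX \<alpha>\<in>multi_indices n (d div 2).
                    Lambda n (d - 2 * mdeg \<alpha>) (F \<alpha>) / sphere_norm n (F \<alpha>))))"
proof (intro exI[of _ 7] conjI allI impI)
  fix n d f
  assume n: "n \<ge> 1" and d: "even d" and f: "variate n f" "homogeneous d f"
  show "\<exists>!F. multilinear_decomposition n d f F"
    using multilinear_decomposition_exists[OF f] multilinear_decomposition_unique by blast
  fix F assume dec: "multilinear_decomposition n d f F"
  let ?R = "MAX \<alpha>\<in>multi_indices n (d div 2).
      Lambda n (d - 2 * mdeg \<alpha>) (F \<alpha>) / sphere_norm n (F \<alpha>)"
  show "Lambda n d f / sphere_norm n f \<le> 2 powr (7 * real d) * ?R"
  \<comment> \<open>In degree 0 the only index is 0 and its part is \<open>f\<close> itself, so both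
    sides are equal. The maximum may be negative here, hence the separate case.\<close>
  proof (cases "d = 0")
    case True
    then have "f = F 0"
      using dec by (simp add: multilinear_decomposition_def multi_indices_0)
    then show ?thesis using True by (simp add: multi_indices_0)
  next
    case False
    with d have "d \<ge> 2" by presburger
    then show ?thesis
      by (rule Lambda_multilinear_ratio_le[OF n d _ f dec])
        (intro Max_ge finite_imageI finite_multi_indices imageI)
  qed
qed simp

end
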